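(* Let $G$ be a finite group, let $p$ be an odd prime dividing $|G|$, and write $n=n_p(G)$. Then $G$ satisfies one of the following statements: \begin{itemize} \item[(1)] $|G|=n(n+1)$ and $G$ is a Frobenius group with kernel of order $n+1$, and $\mathcal{N}_p(G)$ is the set of nonidentity elements of the Frobenius kernel. \item[(2)] $|G|=\frac{n}{2}(n+2)$ and $G$ is a central extension of a Frobenius group of order $\frac{n}{2}\left(\frac{n}{2}+1\right)$. \item[(3)] $|G|=\frac{n}{2}(n+1)$ and $G$ is a Frobenius group with kernel of order $n+1$, and $\mathcal{N}_p(G)$ is the set of nonidentity elements of the Frobenius kernel. \item[(4)] $|G|\leq \frac{n^2}{2}$. \end{itemize}
   Context: For a finite group $G$ and an integer $k>0$, write $G^{k}=\{x^{k} : x\in G\}$, $\mathcal{N}_k(G)=G\setminus G^{k}$ (the set of elements of $G$ that are not $k$-th powers in $G$), and $n_k(G)=|\mathcal{N}_k(G)|$. "$G$ is a central extension of a group $F$" means that $G$ has a central subgroup $Z$ with $G/Z\cong F$.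
   Formalization: For the group of order 3 with p = 3 (n = 2) none of (1)–(4) holds, since it is not a Frobenius group; statement (3) therefore also admits a trivial complement, with the whole group as kernel, exactly when |G| = 3. *)

theory Defs
  imports Complex_Main "HOL-Computational_Algebra.Primes" "HOL-Algebra.Coset"
begin

definition kth_powers :: "('a, 'b) monoid_scheme \<Rightarrow> nat \<Rightarrow> 'a set"
  where "kth_powers G k = (\<lambda>x. x [^]\<^bsub>G\<^esub> k) ` carrier G"

definition non_kth_powers :: "('a, 'b) monoid_scheme \<Rightarrow> nat \<Rightarrow> 'a set"
  where "non_kth_powers G k = carrier G - kth_powers G k"

definition conj_subset :: "('a, 'b) monoid_scheme \<Rightarrow> 'a \<Rightarrow> 'a set \<Rightarrow> 'a set"
  where "conj_subset G g H = (\<lambda>h. g \<otimes>\<^bsub>G\<^esub> h \<otimes>\<^bsub>G\<^esub> inv\<^bsub>G\<^esub> g) ` H"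

definition frobenius_complement :: "('a, 'b) monoid_scheme \<Rightarrow> 'a set \<Rightarrow> bool"
  where "frobenius_complement G H \<longleftrightarrow>
    subgroup H G \<and> H \<noteq> {\<one>\<^bsub>G\<^esub>} \<and> H \<noteq> carrier G \<and>
    (\<forall>g \<in> carrier G - H. H \<inter> conj_subset G g H = {\<one>\<^bsub>G\<^esub>})"

text \<open>
  The Frobenius kernel is defined for a given complement as the set of elements lying in no
  conjugate of it, together with the identity; that this set is a normal subgroup (in a finite
  group) is Frobenius' theorem and is not part of the definition. For the trivial subgroup in
  place of the complement the formula gives the whole group.
\<close>

definition frobenius_kernel :: "('a, 'b) monoid_scheme \<Rightarrow> 'a set \<Rightarrow> 'a set"
  where "frobenius_kernel G H =
    insert \<one>\<^bsub>G\<^esub> (carrier G - (\<Union>g \<in> carrier G. conj_subset G g H))"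

definition frobenius_group :: "('a, 'b) monoid_scheme \<Rightarrow> bool"
  where "frobenius_group G \<longleftrightarrow>
    group G \<and> finite (carrier G) \<and> (\<exists>H. frobenius_complement G H)"

text \<open>
  A degenerate case: the group of order 3 has 2 elements that are not cubes, so its order is
  \<open>n (n + 1) / 2\<close>, and its non-cubes are the nonidentity elements of a \<open>kernel\<close> (the
  whole group) of order \<open>n + 1\<close>; but the corresponding complement is trivial, which
  \<open>frobenius_complement\<close> excludes. The main statement therefore admits the trivial subgroup
  as a complement for groups of order 3, and only for them.
\<close>

definition central_extension :: "('a, 'b) monoid_scheme \<Rightarrow> ('c, 'd) monoid_scheme \<Rightarrow> bool"
  where "central_extension G F \<longleftrightarrow>
    (\<exists>Z. subgroup Z G \<and> (\<forall>z \<in> Z. \<forall>g \<in> carrier G. z \<otimes>\<^bsub>G\<^esub> g = g \<otimes>\<^bsub>G\<^esub> z) \<and>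
         G Mod Z \<cong> F)"

end

theory Submission
  imports Defs "HOL-Algebra.Sylow" "HOL-Algebra.Group_Action" "HOL-Algebra.Multiplicative_Group"
    "HOL-Algebra.FiniteProduct"
begin

text \<open>
  Let \<open>p * e\<close> be an exponent of \<open>G\<close> such that \<open>e\<close> is not one. Every \<open>y\<close> with \<open>y [^] e \<noteq> \<one>\<close> is a
  non-\<open>p\<close>-th power, and if \<open>x\<close> is such an element, then among \<open>h\<close>, \<open>h x\<close>, \<open>h x x\<close> with \<open>h\<close> in the
  centralizer \<open>C(x)\<close> at least two are. Hence \<open>2 |C(x)| \<le> 3 n\<close>, and if \<open>|G| > n\<^sup>2 / 2\<close>, each of
  these conjugacy classes has more than \<open>n / 3\<close> elements, so there are at most two of them.

  If \<open>p\<close> divides \<open>e\<close>, let \<open>k\<close> be a power of the \<open>p\<close>-element \<open>x\<close> with \<open>k\<close> of order \<open>p\<close>. Two of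
  \<open>x\<close>, \<open>x k\<close>, \<open>x k k\<close> are then conjugate, and the counting argument, applied to three cosets
  of \<open>C(x)\<close> instead of one, gives \<open>2 |C(x)| \<le> n\<close>, whence \<open>|G| \<le> n\<^sup>2 / 2\<close>. If \<open>p\<close> does not divide \<open>e\<close>, the
  non-\<open>p\<close>-th powers are the products \<open>u w\<close> with \<open>u\<close> of order \<open>p\<close> and \<open>w\<close> a \<open>p\<close>-regular element
  of \<open>C(u)\<close>. By the bound on class sizes either all \<open>w\<close> are trivial and there are one or two classes
  of elements of order \<open>p\<close>, or there is one class and one nontrivial \<open>w\<close> for each \<open>u\<close>. These
  cases lead to (1), (3) and (2): the centralizer (modulo \<open>w\<close> in the last case) turns out to be
  normal and to centralize each of its nonidentity elements, and averaging a transversal yields a complement.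
\<close>

subsection \<open>Conjugation and centralizers\<close>

context group
begin

definition conjugate :: "'a \<Rightarrow> 'a \<Rightarrow> 'a"
  where "conjugate g x = g \<otimes> x \<otimes> inv g"

definition centralizer :: "'a \<Rightarrow> 'a set"
  where "centralizer x = {g \<in> carrier G. g \<otimes> x = x \<otimes> g}"

definition conj_class :: "'a \<Rightarrow> 'a set"
  where "conj_class x = (\<lambda>g. conjugate g x) ` carrier G"

lemma inv_mult_cancel [simp]:
  assumes "x \<in> carrier G" "y \<in> carrier G"
  shows "inv x \<otimes> (x \<otimes> y) = y" "x \<otimes> (inv x \<otimes> y) = y"
  using assms by (simp_all flip: m_assoc)

lemma conjugate_closed [simp]: "g \<in> carrier G \<Longrightarrow> x \<in> carrier G \<Longrightarrow> conjugate g x \<in> carrier G"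
  by (simp add: conjugate_def)

lemma conjugate_one [simp]: "g \<in> carrier G \<Longrightarrow> conjugate g \<one> = \<one>"
  by (simp add: conjugate_def)

lemma one_conjugate [simp]: "x \<in> carrier G \<Longrightarrow> conjugate \<one> x = x"
  by (simp add: conjugate_def)

lemma conjugate_mult:
  assumes "g \<in> carrier G" "x \<in> carrier G" "y \<in> carrier G"
  shows "conjugate g (x \<otimes> y) = conjugate g x \<otimes> conjugate g y"
  using assms by (simp add: conjugate_def m_assoc)

lemma conjugate_conjugate:
  assumes "g \<in> carrier G" "h \<in> carrier G" "x \<in> carrier G"
  shows "conjugate g (conjugate h x) = conjugate (g \<otimes> h) x"
  using assms by (simp add: conjugate_def m_assoc inv_mult_group)

lemma conjugate_inv_cancel [simp]:
  assumes "g \<in> carrier G" "x \<in> carrier G"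
  shows "conjugate (inv g) (conjugate g x) = x" "conjugate g (conjugate (inv g) x) = x"
  using assms by (simp_all add: conjugate_conjugate)

lemma conjugate_inj: "g \<in> carrier G \<Longrightarrow> inj_on (conjugate g) (carrier G)"
  by (metis conjugate_inv_cancel(1) inj_onI)

lemma conjugate_eq_iff:
  assumes "g \<in> carrier G" "x \<in> carrier G" "y \<in> carrier G"
  shows "conjugate g x = conjugate g y \<longleftrightarrow> x = y"
  using assms by (metis conjugate_inv_cancel(1))

lemma conjugate_eq_one_iff:
  assumes "g \<in> carrier G" "x \<in> carrier G"
  shows "conjugate g x = \<one> \<longleftrightarrow> x = \<one>"
  using assms by (metis conjugate_eq_iff conjugate_one one_closed)

lemma conjugate_pow:
  assumes "g \<in> carrier G" "x \<in> carrier G"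
  shows "conjugate g (x [^] (n::nat)) = conjugate g x [^] n"
  using assms by (induction n) (simp_all add: conjugate_mult)

lemma conjugate_inv:
  assumes "g \<in> carrier G" "x \<in> carrier G"
  shows "conjugate g (inv x) = inv (conjugate g x)"
  using assms by (simp add: conjugate_def m_assoc inv_mult_group)

lemma conjugate_eq_self_iff:
  assumes "g \<in> carrier G" "x \<in> carrier G"
  shows "conjugate g x = x \<longleftrightarrow> g \<in> centralizer x"
  using assms by (auto simp: conjugate_def centralizer_def inv_solve_right')

lemma centralizer_subset: "centralizer x \<subseteq> carrier G"
  by (auto simp: centralizer_def)

lemma centralizer_sym: "x \<in> carrier G \<Longrightarrow> y \<in> centralizer x \<Longrightarrow> x \<in> centralizer y"
  by (simp add: centralizer_def)

lemma centralizer_self: "x \<in> carrier G \<Longrightarrow> x \<in> centralizer x"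
  by (simp add: centralizer_def)

lemma subgroup_centralizer:
  assumes "x \<in> carrier G"
  shows "subgroup (centralizer x) G"
proof (rule subgroupI)
  show "inv a \<in> centralizer x" if "a \<in> centralizer x" for a
  proof -
    have a: "a \<in> carrier G" "conjugate a x = x"
      using that assms centralizer_subset conjugate_eq_self_iff by blast+
    hence "conjugate (inv a) x = x"
      using assms by (metis conjugate_inv_cancel(1))
    thus ?thesis using a assms conjugate_eq_self_iff by blast
  qed
  show "a \<otimes> b \<in> centralizer x" if "a \<in> centralizer x" "b \<in> centralizer x" for a b
  proof -
    have "a \<in> carrier G" "b \<in> carrier G" "conjugate a x = x" "conjugate b x = x"
      using that assms centralizer_subset conjugate_eq_self_iff by blast+
    thus ?thesis using assms by (metis conjugate_conjugate conjugate_eq_self_iff m_closed)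
  qed
qed (use assms in \<open>auto simp: centralizer_def\<close>)

lemma centralizer_conjugate:
  assumes "g \<in> carrier G" "x \<in> carrier G"
  shows "centralizer (conjugate g x) = conjugate g ` centralizer x"
proof
  have *: "conjugate g y \<in> centralizer (conjugate g x)" if "y \<in> centralizer x" "g \<in> carrier G" "x \<in> carrier G" for g x y
    using that by (auto simp: centralizer_def simp flip: conjugate_mult)
  show "conjugate g ` centralizer x \<subseteq> centralizer (conjugate g x)"
    using * assms by blast
  show "centralizer (conjugate g x) \<subseteq> conjugate g ` centralizer x"
  proof
    fix y assume y: "y \<in> centralizer (conjugate g x)"
    hence "conjugate (inv g) y \<in> centralizer x"
      using *[OF y, of "inv g"] assms by simp
    moreover have "y = conjugate g (conjugate (inv g) y)"
      using y assms centralizer_subset by (metis conjugate_inv_cancel(2) subsetD)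
    ultimately show "y \<in> conjugate g ` centralizer x" by blast
  qed
qed

lemma card_centralizer_conjugate:
  assumes "g \<in> carrier G" "x \<in> carrier G"
  shows "card (centralizer (conjugate g x)) = card (centralizer x)"
  unfolding centralizer_conjugate[OF assms] using assms conjugate_inj centralizer_subset
  by (meson card_image inj_on_subset)

lemma card_conj_class:
  assumes "x \<in> carrier G"
  shows "card (conj_class x) * card (centralizer x) = order G"
proof -
  interpret A: group_action G "carrier G" "\<lambda>g. \<lambda>h \<in> carrier G. g \<otimes> h \<otimes> inv g"
    by (rule action_by_conjugation)
  have "orbit G (\<lambda>g. \<lambda>h \<in> carrier G. g \<otimes> h \<otimes> inv g) x = conj_class x"
    using assms by (auto simp: orbit_def conj_class_def conjugate_def)
  moreover have "stabilizer G (\<lambda>g. \<lambda>h \<in> carrier G. g \<otimes> h \<otimes> inv g) x = centralizer x"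
    using assms conjugate_eq_self_iff[of _ x] by (auto simp: stabilizer_def conjugate_def centralizer_def)
  ultimately show ?thesis
    using A.orbit_stabilizer_theorem[OF assms] by simp
qed

lemma conj_class_self: "x \<in> carrier G \<Longrightarrow> x \<in> conj_class x"
  unfolding conj_class_def by (metis image_eqI one_conjugate one_closed)

lemma conj_class_eq:
  assumes "x \<in> carrier G" "y \<in> conj_class x"
  shows "conj_class y = conj_class x"
proof -
  have *: "conj_class (conjugate g x) \<subseteq> conj_class x" if "g \<in> carrier G" "x \<in> carrier G" for g x
    using that by (auto simp: conj_class_def conjugate_conjugate)
  obtain g where g: "g \<in> carrier G" "y = conjugate g x"
    using assms by (auto simp: conj_class_def)
  have "conj_class x \<subseteq> conj_class y"
    using *[of "inv g" y] g assms by simp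
  thus ?thesis using *[of g x] g assms by blast
qed

lemma conj_class_disjoint:
  assumes "x \<in> carrier G" "y \<in> carrier G" "y \<notin> conj_class x"
  shows "conj_class x \<inter> conj_class y = {}"
  using assms by (metis conj_class_eq conj_class_self disjoint_iff)

lemma card_subgroup_dvd:
  assumes "subgroup H G" "subgroup K G" "H \<subseteq> K"
  shows "card H dvd card K"
proof -
  interpret K: group "G\<lparr>carrier := K\<rparr>"
    using assms by (simp add: subgroup_imp_group)
  have "subgroup H (G\<lparr>carrier := K\<rparr>)"
    using assms by (simp add: subgroup_incl)
  from K.lagrange[OF this] show ?thesis
    by (simp add: order_def) (metis dvd_triv_right)
qed

subsection \<open>Complements of abelian normal subgroups\<close>

lemma mult_inv_eq_one_iff:
  assumes "x \<in> carrier G" "y \<in> carrier G"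
  shows "x \<otimes> inv y = \<one> \<longleftrightarrow> x = y"
  using assms by (metis inv_solve_right' l_one one_closed)

lemma inv_mult_eq_one_iff:
  assumes "x \<in> carrier G" "y \<in> carrier G"
  shows "inv x \<otimes> y = \<one> \<longleftrightarrow> y = x"
  using assms by (metis inv_solve_left' r_one one_closed)

lemma conjugate_in_normal:
  assumes "P \<lhd> G" "g \<in> carrier G" "u \<in> P"
  shows "conjugate g u \<in> P"
  using assms by (simp add: conjugate_def normal.inv_op_closed2)

text \<open>Averaging a transversal, as in the abelian case of the Schur-Zassenhaus theorem: its
  deviations from being multiplicative have as product over the quotient a crossed homomorphism
  \<open>\<phi>\<close> into \<open>P\<close>. By \<open>tor\<close>, raising to the power of the
  index is injective on \<open>P\<close>, hence bijective, so the kernel of \<open>\<phi>\<close>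
  meets every coset of \<open>P\<close>.\<close>

lemma abelian_normal_complement:
  assumes P: "P \<lhd> G" and fin: "finite (carrier G)"
    and comm: "\<And>u v. u \<in> P \<Longrightarrow> v \<in> P \<Longrightarrow> u \<otimes> v = v \<otimes> u"
    and tor: "\<And>u. u \<in> P \<Longrightarrow> u [^] card (rcosets P) = \<one> \<Longrightarrow> u = \<one>"
  obtains H where "subgroup H G" "H \<inter> P = {\<one>}" "\<And>g. g \<in> carrier G \<Longrightarrow> \<exists>u\<in>P. u \<otimes> g \<in> H"
proof -
  interpret P: normal P G by (rule P)
  have PG: "u \<in> carrier G" if "u \<in> P" for u
    using that P.subset by blast
  define Q where "Q = G Mod P"
  define K where "K = G\<lparr>carrier := P\<rparr>"
  interpret Q: group Q
    unfolding Q_def by (rule P.factorgroup_is_group)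
  have "group K"
    unfolding K_def using P.subgroup_axioms by (rule subgroup_imp_group)
  then interpret K: comm_group K
    by (rule group.group_comm_groupI) (simp add: K_def comm)
  have K_simps [simp]: "carrier K = P" "mult K = mult G" "one K = \<one>"
    by (simp_all add: K_def)
  have K_pow: "u [^]\<^bsub>K\<^esub> n = u [^] n" for u and n :: nat
    unfolding K_def by (simp flip: nat_pow_consistent)
  have finQ: "finite (carrier Q)"
    using fin by (simp add: Q_def carrier_FactGroup)
  have hom: "P #> (g \<otimes> h) = (P #> g) \<otimes>\<^bsub>Q\<^esub> (P #> h)" if "g \<in> carrier G" "h \<in> carrier G" for g h
    using that by (simp add: Q_def P.rcos_sum)
  have PQ: "P #> g \<in> carrier Q" if "g \<in> carrier G" for g
    using that by (auto simp: Q_def carrier_FactGroup)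
  define \<tau> where "\<tau> C = (SOME g. g \<in> carrier G \<and> P #> g = C)" for C
  have \<tau>: "\<tau> C \<in> carrier G" "P #> \<tau> C = C" if "C \<in> carrier Q" for C
  proof -
    have "\<exists>g. g \<in> carrier G \<and> P #> g = C"
      using that by (auto simp: Q_def carrier_FactGroup)
    from someI_ex[OF this] show "\<tau> C \<in> carrier G" "P #> \<tau> C = C"
      by (auto simp: \<tau>_def)
  qed
  \<comment> \<open>The element of \<open>P\<close> by which left multiplication by \<open>g\<close>
    takes the representative \<open>\<tau> C\<close> away from the representative of the image
    coset.\<close>
  define f where "f g C = g \<otimes> \<tau> C \<otimes> inv (\<tau> ((P #> g) \<otimes>\<^bsub>Q\<^esub> C))" for g C
  have f_in: "f g C \<in> P" if "g \<in> carrier G" "C \<in> carrier Q" for g C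
  proof -
    let ?D = "(P #> g) \<otimes>\<^bsub>Q\<^esub> C"
    have D: "?D \<in> carrier Q" using that PQ by simp
    have "P #> (g \<otimes> \<tau> C) = P #> \<tau> ?D"
      using that D \<tau> by (simp add: hom)
    hence "g \<otimes> \<tau> C \<in> P #> \<tau> ?D"
      using that \<tau> rcos_self[OF _ P.subgroup_axioms, of "g \<otimes> \<tau> C"] by simp
    thus ?thesis
      unfolding f_def using that D \<tau>
      by (subst (asm) P.rcos_module[OF is_group]) auto
  qed
  \<comment> \<open>\<open>\<phi>\<close> is a crossed homomorphism that restricts to the bijection \<open>u \<mapsto> u [^] m\<close> on \<open>P\<close>;
      its kernel is the complement.\<close>
  define \<phi> where "\<phi> g = finprod K (f g) (carrier Q)" for g
  have \<phi>_in: "\<phi> g \<in> P" if "g \<in> carrier G" for g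
    unfolding \<phi>_def using K.finprod_closed[of "f g" "carrier Q"] f_in that by auto
  have conjugate_prod: "conjugate g (finprod K F X) = finprod K (\<lambda>C. conjugate g (F C)) X"
    if "finite X" "g \<in> carrier G" "F \<in> X \<rightarrow> P" for g F and X :: "'a set set"
    using that
  proof (induction X rule: finite_induct)
    case (insert C X)
    have "finprod K F X \<in> P" using K.finprod_closed[of F X] insert by auto
    moreover have "F C \<in> P" using insert by auto
    moreover have "(\<lambda>C. conjugate g (F C)) \<in> X \<rightarrow> P"
      using insert P conjugate_in_normal by auto
    ultimately show ?case
      using insert P by (simp add: K.finprod_insert Pi_iff conjugate_mult PG conjugate_in_normal)
  qed simp
  have \<phi>_mult: "\<phi> (g \<otimes> h) = conjugate g (\<phi> h) \<otimes> \<phi> g" if gh: "g \<in> carrier G" "h \<in> carrier G" for g h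
  proof -
    let ?L = "\<lambda>C. (P #> h) \<otimes>\<^bsub>Q\<^esub> C"
    \<comment> \<open>Left translation by the coset of \<open>h\<close> permutes the quotient, so
      the product of the factors \<open>f g (?L C)\<close> is again \<open>\<phi> g\<close>.\<close>
    have L: "?L ` carrier Q = carrier Q" "inj_on ?L (carrier Q)"
      using Q.surj_const_mult[OF PQ[OF gh(2)]] Q.inj_on_multc PQ[OF gh(2)]
        Q.inj_on_cmult by auto
    have f_split: "f (g \<otimes> h) C = conjugate g (f h C) \<otimes> f g (?L C)" if C: "C \<in> carrier Q" for C
    proof -
      have D: "?L C \<in> carrier Q" using C gh PQ by simp
      have E: "(P #> g) \<otimes>\<^bsub>Q\<^esub> ?L C \<in> carrier Q" using D gh PQ by simp
      have "(P #> (g \<otimes> h)) \<otimes>\<^bsub>Q\<^esub> C = (P #> g) \<otimes>\<^bsub>Q\<^esub> ?L C"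
        using gh C PQ by (simp add: hom Q.m_assoc)
      thus ?thesis
        unfolding f_def conjugate_def using gh \<tau>[OF C] \<tau>[OF D] \<tau>[OF E]
        by (simp add: m_assoc)
    qed
    have "\<phi> (g \<otimes> h) = finprod K (\<lambda>C. conjugate g (f h C) \<otimes>\<^bsub>K\<^esub> f g (?L C)) (carrier Q)"
      unfolding \<phi>_def using gh f_in P PQ
      by (intro K.finprod_cong') (auto simp: f_split conjugate_in_normal)
    also have "\<dots> = finprod K (\<lambda>C. conjugate g (f h C)) (carrier Q) \<otimes>\<^bsub>K\<^esub> finprod K (\<lambda>C. f g (?L C)) (carrier Q)"
      using gh f_in P PQ by (intro K.finprod_multf) (auto simp: conjugate_in_normal)
    also have "finprod K (\<lambda>C. f g (?L C)) (carrier Q) = finprod K (f g) (?L ` carrier Q)"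
      using L gh f_in by (intro K.finprod_reindex[symmetric]) auto
    also have "\<dots> = \<phi> g" by (simp add: L \<phi>_def)
    also have "finprod K (\<lambda>C. conjugate g (f h C)) (carrier Q) = conjugate g (\<phi> h)"
      unfolding \<phi>_def using finQ gh f_in by (intro conjugate_prod[symmetric]) auto
    finally show ?thesis by simp
  qed
  let ?m = "card (rcosets P)"
  have \<phi>_P: "\<phi> u = u [^] ?m" if u: "u \<in> P" for u
  proof -
    have "f u C = u" if C: "C \<in> carrier Q" for C
    proof -
      have "P #> u = \<one>\<^bsub>Q\<^esub>"
        using u by (simp add: Q_def P.rcos_const[OF is_group])
      hence "f u C = u \<otimes> \<tau> C \<otimes> inv (\<tau> C)"
        unfolding f_def using C by simp
      thus ?thesis using u PG \<tau>[OF C] by (simp add: m_assoc)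
    qed
    hence "\<phi> u = finprod K (\<lambda>_. u) (carrier Q)"
      unfolding \<phi>_def using u by (intro K.finprod_cong') auto
    also have "\<dots> = u [^]\<^bsub>K\<^esub> card (carrier Q)"
      using u by (intro K.finprod_const) auto
    finally show ?thesis
      by (simp add: K_pow Q_def FactGroup_def)
  qed
  have powinj: "inj_on (\<lambda>u. u [^] ?m) P"
  proof (rule inj_onI)
    fix u v assume uv: "u \<in> P" "v \<in> P" "u [^] ?m = v [^] ?m"
    have "(u \<otimes> inv v) [^] ?m = u [^] ?m \<otimes> (inv v) [^] ?m"
      using uv comm PG by (intro pow_mult_distrib) auto
    also have "\<dots> = \<one>" using uv PG by (simp add: nat_pow_inv)
    finally have "u \<otimes> inv v = \<one>" using tor uv by simp
    thus "u = v" using uv PG by (simp add: mult_inv_eq_one_iff)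
  qed
  have "finite P" using fin P.subset by (rule rev_finite_subset)
  have "u [^] ?m \<in> P" if "u \<in> P" for u using \<phi>_P[OF that] \<phi>_in PG that by metis
  hence "(\<lambda>u. u [^] ?m) ` P = P"
    using powinj \<open>finite P\<close> by (intro endo_inj_surj) auto
  hence surj: "\<exists>u\<in>P. u [^] ?m = v" if "v \<in> P" for v
    using that by (metis (no_types, lifting) imageE)
  define H where "H = {g \<in> carrier G. \<phi> g = \<one>}"
  show ?thesis
  proof (rule that)
    have "\<phi> \<one> = \<one>" using \<phi>_P[of \<one>] by simp
    show "subgroup H G"
    proof (rule subgroupI)
      show "inv a \<in> H" if "a \<in> H" for a
      proof -
        have a: "a \<in> carrier G" "\<phi> a = \<one>" using that by (auto simp: H_def)
        have "\<phi> (inv a \<otimes> a) = conjugate (inv a) (\<phi> a) \<otimes> \<phi> (inv a)"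
          using a by (intro \<phi>_mult) auto
        thus ?thesis using a \<open>\<phi> \<one> = \<one>\<close> \<phi>_in[of "inv a"] PG by (simp add: H_def)
      qed
      show "a \<otimes> b \<in> H" if "a \<in> H" "b \<in> H" for a b
        using that by (auto simp: H_def \<phi>_mult)
    qed (use \<open>\<phi> \<one> = \<one>\<close> in \<open>auto simp: H_def\<close>)
    show "H \<inter> P = {\<one>}"
      using \<open>\<phi> \<one> = \<one>\<close> tor \<phi>_P by (auto simp: H_def)
    show "\<exists>u\<in>P. u \<otimes> g \<in> H" if g: "g \<in> carrier G" for g
    proof -
      \<comment> \<open>Chosen to cancel \<open>\<phi> g\<close>: as \<open>P\<close> is
        commutative, \<open>\<phi> (u \<otimes> g)\<close> is
        \<open>\<phi> g \<otimes> u [^] ?m\<close>.\<close>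
      obtain u where u: "u \<in> P" "u [^] ?m = inv (\<phi> g)"
        using surj[of "inv (\<phi> g)"] \<phi>_in[OF g] by auto
      have "conjugate u (\<phi> g) = \<phi> g"
        using u \<phi>_in[OF g] PG comm by (simp add: conjugate_eq_self_iff centralizer_def)
      hence "\<phi> (u \<otimes> g) = \<one>"
        using u g \<phi>_in[OF g] PG by (simp add: \<phi>_mult \<phi>_P)
      thus ?thesis using u g PG by (auto simp: H_def)
    qed
  qed
qed

section \<open>Frobenius kernels from self-centralizing normal subgroups\<close>

lemma conj_subset_eq: "conj_subset G g H = conjugate g ` H"
  by (simp add: conj_subset_def conjugate_def)

text \<open>An element outside \<open>P\<close> commutes with no nonidentity element of
  \<open>P\<close>. Hence for each \<open>h \<noteq> \<one>\<close> in \<open>H\<close> the coset of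
  \<open>h\<close> modulo \<open>P\<close> consists of \<open>P\<close>-conjugates of
  \<open>h\<close>, and these cosets cover everything outside \<open>P\<close>.\<close>

lemma complement_frobenius:
  assumes P: "P \<lhd> G" and fin: "finite (carrier G)"
    and centralizer: "\<And>u. u \<in> P \<Longrightarrow> u \<noteq> \<one> \<Longrightarrow> centralizer u = P"
    and H: "subgroup H G" "H \<inter> P = {\<one>}" "\<And>g. g \<in> carrier G \<Longrightarrow> \<exists>u\<in>P. u \<otimes> g \<in> H"
  shows "frobenius_kernel G H = P"
    and "P \<noteq> {\<one>} \<Longrightarrow> P \<noteq> carrier G \<Longrightarrow> frobenius_complement G H"
proof -
  interpret P: normal P G by (rule P)
  interpret H: subgroup H G by (rule H)
  have PG: "u \<in> carrier G" if "u \<in> P" for u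
    using that P.subset by blast
  have fixP: "u = \<one>" if "u \<in> P" "u \<in> centralizer h" "h \<in> carrier G" "h \<notin> P" for u h
    using that centralizer centralizer_sym by blast
  have fixH: "u = \<one> \<or> h = \<one>" if "u \<in> P" "u \<in> centralizer h" "h \<in> H" for u h
    using fixP[of u h] that H(2) by auto
  \<comment> \<open>The map sending \<open>u\<close> to the commutator of \<open>u\<close> and
    \<open>h\<close> is injective on the finite set \<open>P\<close>, hence onto
    \<open>P\<close>.\<close>
  have conjH: "\<exists>u\<in>P. conjugate u h = v \<otimes> h" if v: "v \<in> P" and h: "h \<in> H" "h \<noteq> \<one>" for v h
  proof -
    have hG: "h \<in> carrier G" "h \<notin> P" using h H(2) by auto
    have inj: "inj_on (\<lambda>u. conjugate u h \<otimes> inv h) P"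
    proof (rule inj_onI)
      fix u w assume uw: "u \<in> P" "w \<in> P" "conjugate u h \<otimes> inv h = conjugate w h \<otimes> inv h"
      hence "conjugate u h = conjugate w h"
        using hG PG by simp
      hence "conjugate (inv w \<otimes> u) h = h"
        using uw hG PG by (simp flip: conjugate_conjugate)
      hence "inv w \<otimes> u \<in> centralizer h"
        using uw hG PG by (simp add: conjugate_eq_self_iff)
      hence "inv w \<otimes> u = \<one>" using fixP[of "inv w \<otimes> u" h] uw hG by simp
      thus "u = w" using uw PG by (simp add: inv_mult_eq_one_iff)
    qed
    have "conjugate u h \<otimes> inv h \<in> P" if "u \<in> P" for u
    proof -
      have "conjugate u h \<otimes> inv h = u \<otimes> conjugate h (inv u)"
        using that PG hG by (simp add: conjugate_def m_assoc)
      thus ?thesis using that P hG conjugate_in_normal by simp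
    qed
    hence "(\<lambda>u. conjugate u h \<otimes> inv h) ` P = P"
      using inj fin P.subset by (intro endo_inj_surj) (auto intro: finite_subset)
    then obtain u where "u \<in> P" "v = conjugate u h \<otimes> inv h"
      using v by (metis (no_types, lifting) imageE)
    hence "conjugate u h = v \<otimes> h"
      using hG PG by (simp add: m_assoc)
    thus ?thesis using \<open>u \<in> P\<close> by blast
  qed
  have decomp: "\<exists>v\<in>P. \<exists>h\<in>H. g = v \<otimes> h" if g: "g \<in> carrier G" for g
  proof -
    obtain u where u: "u \<in> P" "u \<otimes> g \<in> H" using H(3) g by blast
    have "g = inv u \<otimes> (u \<otimes> g)" using u g PG by (simp flip: m_assoc)
    thus ?thesis using u by blast
  qed
  show "frobenius_kernel G H = P"
  proof (intro equalityI subsetI)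
    fix g assume g: "g \<in> frobenius_kernel G H"
    show "g \<in> P"
    proof (rule ccontr)
      assume gP: "g \<notin> P"
      hence "g \<noteq> \<one>" by auto
      hence g': "g \<in> carrier G" "\<And>u. u \<in> carrier G \<Longrightarrow> g \<notin> conjugate u ` H"
        using g by (auto simp: frobenius_kernel_def conj_subset_eq)
      obtain v h where vh: "v \<in> P" "h \<in> H" "g = v \<otimes> h" using decomp g' by blast
      hence "h \<noteq> \<one>" using gP PG by auto
      then obtain u where "u \<in> P" "conjugate u h = g" using conjH vh by metis
      thus False using g'(2)[of u] vh PG by blast
    qed
  next
    fix g assume g: "g \<in> P"
    have "g = \<one>" if u: "u \<in> carrier G" "g = conjugate u h" "h \<in> H" for u h
    proof -
      have "h = conjugate (inv u) g" using u by auto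
      hence "h \<in> P" using conjugate_in_normal[OF P, of "inv u" g] g u by simp
      hence "h = \<one>" using u H(2) by auto
      thus ?thesis using u by simp
    qed
    thus "g \<in> frobenius_kernel G H"
      using g PG by (auto simp: frobenius_kernel_def conj_subset_eq)
  qed
  show "frobenius_complement G H" if "P \<noteq> {\<one>}" "P \<noteq> carrier G"
    unfolding frobenius_complement_def
  proof (intro conjI ballI)
    show "H \<noteq> {\<one>}"
    proof
      assume "H = {\<one>}"
      hence "carrier G \<subseteq> P" using decomp PG by fastforce
      thus False using that P.subset by blast
    qed
    show "H \<noteq> carrier G" using H(2) that P.subset by auto
    show "H \<inter> conj_subset G g H = {\<one>}" if g: "g \<in> carrier G - H" for g
    proof (intro equalityI subsetI)
      fix h assume "h \<in> H \<inter> conj_subset G g H"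
      then obtain k where k: "k \<in> H" "h = conjugate g k" "h \<in> H" by (auto simp: conj_subset_eq)
      obtain v a where va: "v \<in> P" "a \<in> H" "g = v \<otimes> a" using decomp g by blast
      have "v \<noteq> \<one>" using va g by auto
      define b where "b = conjugate a k"
      have b: "b \<in> H" using va k by (simp add: b_def conjugate_def)
      have hb: "h = conjugate v b" using va k PG by (simp add: b_def conjugate_conjugate)
      \<comment> \<open>Both \<open>h\<close> and \<open>b\<close> lie in \<open>H\<close> and
        differ by an element of \<open>P\<close>, so they agree; then \<open>v\<close> centralizes
        \<open>b\<close>, which forces \<open>b = \<one>\<close>.\<close>
      have "h \<otimes> inv b = v \<otimes> conjugate b (inv v)"
        using hb va b PG by (simp add: conjugate_def m_assoc)
      hence "h \<otimes> inv b \<in> P" using va b P conjugate_in_normal by simp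
      hence "h \<otimes> inv b = \<one>" using k b H(2) by auto
      hence "h = b" using k b by (simp add: mult_inv_eq_one_iff)
      hence "v \<in> centralizer b" using hb va PG b conjugate_eq_self_iff[of v b] by simp
      hence "b = \<one>" using fixH va b \<open>v \<noteq> \<one>\<close> by blast
      thus "h \<in> {\<one>}" using \<open>h = b\<close> by simp
    next
      fix h assume "h \<in> {\<one>}"
      thus "h \<in> H \<inter> conj_subset G g H"
        using g by (auto simp: conj_subset_eq intro!: image_eqI[of _ _ \<one>])
    qed
  qed (rule H)
qed

text \<open>The condition on the cardinality makes the index \<open>m\<close> of \<open>P\<close> coprime to \<open>card P\<close>.\<close>

lemma self_centralizing_frobenius:
  assumes P: "P \<lhd> G" and fin: "finite (carrier G)"
    and centralizer: "\<And>u. u \<in> P \<Longrightarrow> u \<noteq> \<one> \<Longrightarrow> centralizer u = P"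
    and card: "card P = k * m + 1" "order G = card P * m"
  obtains H where "subgroup H G" "H \<inter> P = {\<one>}" "frobenius_kernel G H = P"
    "P \<noteq> {\<one>} \<Longrightarrow> P \<noteq> carrier G \<Longrightarrow> frobenius_complement G H"
proof -
  interpret P: normal P G by (rule P)
  have PG: "u \<in> carrier G" if "u \<in> P" for u
    using that P.subset by blast
  have comm: "u \<otimes> v = v \<otimes> u" if "u \<in> P" "v \<in> P" for u v
  proof (cases "u = \<one>")
    case False
    hence "v \<in> centralizer u" using that centralizer by simp
    thus ?thesis by (simp add: centralizer_def)
  qed (use that PG in simp)
  have "card (rcosets P) * card P = card P * m"
    using lagrange[OF P.subgroup_axioms] card by simp
  hence idx: "card (rcosets P) = m" using card(1) by (metis mult.commute mult_cancel1 add_is_0 one_neq_zero)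
  have tor: "u = \<one>" if u: "u \<in> P" "u [^] card (rcosets P) = \<one>" for u
  proof -
    interpret K: group "G\<lparr>carrier := P\<rparr>"
      using P.subgroup_axioms by (rule subgroup_imp_group)
    have "u [^]\<^bsub>G\<lparr>carrier := P\<rparr>\<^esub> order (G\<lparr>carrier := P\<rparr>) = \<one>"
      using u K.pow_order_eq_1[of u] by simp
    hence "u [^] card P = \<one>" by (simp add: order_def flip: nat_pow_consistent)
    hence "u [^] (m * k + 1) = \<one>" using card by (simp add: mult.commute)
    moreover have "u [^] (m * k) = \<one>"
      using u idx PG by (metis nat_pow_one nat_pow_pow)
    ultimately show ?thesis using u PG by (simp flip: nat_pow_mult)
  qed
  obtain H where H: "subgroup H G" "H \<inter> P = {\<one>}" "\<And>g. g \<in> carrier G \<Longrightarrow> \<exists>u\<in>P. u \<otimes> g \<in> H"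
    using abelian_normal_complement[OF P fin comm tor] by metis
  show ?thesis
    using that[OF H(1,2)] complement_frobenius[OF P fin centralizer H] by blast
qed

subsection \<open>Powers and translates\<close>

lemma pow_coprime_eq_one:
  assumes "x \<in> carrier G" "x [^] (a::nat) = \<one>" "x [^] (b::nat) = \<one>" "coprime a b"
  shows "x = \<one>"
  using assms by (metis coprime_common_divisor_nat ord_eq_1 pow_eq_id)

lemma pow_eq_one_dvd:
  assumes "x \<in> carrier G" "x [^] (a::nat) = \<one>" "a dvd b"
  shows "x [^] b = \<one>"
  using assms by (metis dvd_trans pow_eq_id)

text \<open>The elements of \<open>Q\<close> killed by the \<open>e\<close>-th power, and their
  translates by \<open>x\<close> and by \<open>x \<otimes> x\<close>, have \<open>e\<close>-th
  powers \<open>\<one>\<close>, \<open>x [^] e\<close> and its square. These are distinct, so the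
  three sets are disjoint.\<close>

lemma three_translates:
  assumes Q: "finite Q" "Q \<subseteq> carrier G" and x: "x \<in> carrier G"
    and cl: "\<And>h. h \<in> Q \<Longrightarrow> h \<otimes> x \<in> Q"
    and pw: "\<And>h. h \<in> Q \<Longrightarrow> (h \<otimes> x) [^] e = h [^] e \<otimes> x [^] e"
    and ne: "x [^] e \<noteq> \<one>" "x [^] e \<otimes> x [^] e \<noteq> \<one>"
  shows "3 * card {h \<in> Q. h [^] (e::nat) = \<one>} \<le> card Q"
proof -
  define B where "B = {h \<in> Q. h [^] e = \<one>}"
  define B1 where "B1 = (\<lambda>h. h \<otimes> x) ` B"
  define B2 where "B2 = (\<lambda>h. h \<otimes> x) ` B1"
  have sub: "B \<subseteq> Q" "B1 \<subseteq> Q" "B2 \<subseteq> Q"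
    using cl by (auto simp: B_def B1_def B2_def)
  have inj: "inj_on (\<lambda>h. h \<otimes> x) A" if "A \<subseteq> Q" for A
    using that Q x by (intro inj_onI) (metis right_cancel subsetD)
  have c: "card B1 = card B" "card B2 = card B"
    using inj sub by (simp_all add: B1_def B2_def card_image)
  have p0: "h [^] e = \<one>" if "h \<in> B" for h
    using that by (simp add: B_def)
  have p1: "h [^] e = x [^] e" if "h \<in> B1" for h
    using that p0 pw x sub by (auto simp: B1_def)
  have p2: "h [^] e = x [^] e \<otimes> x [^] e" if "h \<in> B2" for h
    using that p1 pw x sub by (auto simp: B2_def)
  have xx: "x [^] e \<noteq> x [^] e \<otimes> x [^] e"
    using ne(1) x by (metis nat_pow_closed r_cancel_one)
  have d: "B \<inter> B1 = {}" "(B \<union> B1) \<inter> B2 = {}"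
    using p0 p1 p2 xx ne by (metis disjoint_iff, metis Un_iff disjoint_iff)
  have fin: "finite B" "finite B1" "finite B2"
    using sub Q finite_subset by blast+
  have "card (B \<union> B1 \<union> B2) = 3 * card B"
    using fin d by (simp add: card_Un_disjoint c)
  moreover have "card (B \<union> B1 \<union> B2) \<le> card Q"
    using sub Q by (intro card_mono) auto
  ultimately show ?thesis by (simp add: B_def)
qed

text \<open>Collection in class two: each of the \<open>n * (n - 1) div 2\<close> pairs in which an
  \<open>x\<close> has to move past a later \<open>h\<close> contributes one commutator
  \<open>k\<close>.\<close>

lemma pow_mult_central_commutator:
  assumes c: "h \<in> carrier G" "x \<in> carrier G" "k \<in> carrier G"
    and comm: "x \<otimes> h = h \<otimes> x \<otimes> k" "h \<otimes> k = k \<otimes> h" "x \<otimes> k = k \<otimes> x"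
  shows "(h \<otimes> x) [^] (n::nat) = h [^] n \<otimes> x [^] n \<otimes> k [^] (n * (n - 1) div 2)"
proof -
  have xk: "x \<otimes> k [^] i = k [^] i \<otimes> x" "h \<otimes> k [^] i = k [^] i \<otimes> h" for i :: nat
    using c comm by (metis group_commutes_pow)+
  have xh: "x [^] i \<otimes> h = h \<otimes> x [^] i \<otimes> k [^] i" for i :: nat
  proof (induction i)
    case (Suc i)
    have "x [^] Suc i \<otimes> h = x [^] i \<otimes> (h \<otimes> x \<otimes> k)"
      using c comm by (simp add: m_assoc)
    also have "\<dots> = (x [^] i \<otimes> h) \<otimes> (x \<otimes> k)"
      using c by (simp add: m_assoc)
    also have "\<dots> = h \<otimes> x [^] i \<otimes> (k [^] i \<otimes> x) \<otimes> k"
      using c by (simp add: Suc m_assoc)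
    also have "\<dots> = h \<otimes> x [^] Suc i \<otimes> k [^] Suc i"
      using c by (simp add: m_assoc flip: xk)
    finally show ?case .
  qed (use c in simp)
  have T: "Suc n * (Suc n - 1) div 2 = n + n * (n - 1) div 2" for n :: nat
    by (cases n) auto
  show ?thesis
  proof (induction n)
    case (Suc n)
    let ?t = "n * (n - 1) div 2"
    have "(h \<otimes> x) [^] Suc n = h [^] n \<otimes> x [^] n \<otimes> (k [^] ?t \<otimes> h) \<otimes> x"
      using c by (simp add: Suc m_assoc)
    also have "\<dots> = h [^] n \<otimes> (x [^] n \<otimes> h) \<otimes> (k [^] ?t \<otimes> x)"
      using c by (simp add: m_assoc flip: xk)
    also have "k [^] ?t \<otimes> x = x \<otimes> k [^] ?t" by (simp add: xk)
    also have "h [^] n \<otimes> (x [^] n \<otimes> h) \<otimes> (x \<otimes> k [^] ?t)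
      = h [^] n \<otimes> h \<otimes> x [^] n \<otimes> (k [^] n \<otimes> x) \<otimes> k [^] ?t"
      using c by (simp add: xh m_assoc)
    also have "k [^] n \<otimes> x = x \<otimes> k [^] n" by (simp add: xk)
    also have "h [^] n \<otimes> h \<otimes> x [^] n \<otimes> (x \<otimes> k [^] n) \<otimes> k [^] ?t
      = h [^] Suc n \<otimes> x [^] Suc n \<otimes> (k [^] n \<otimes> k [^] ?t)"
      using c by (simp add: m_assoc)
    also have "k [^] n \<otimes> k [^] ?t = k [^] (Suc n * (Suc n - 1) div 2)"
      unfolding T using c by (simp only: nat_pow_mult)
    finally show ?case .
  qed simp
qed

end

subsection \<open>Groups with few nonpowers\<close>

text \<open>The assumption \<open>few\<close> denies alternative (4). The number \<open>e\<close>
  will be \<open>p ^ a * m\<close>, chosen so that \<open>p * e\<close> is an exponent of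
  \<open>G\<close> and \<open>e\<close> is not.\<close>

locale few_nonpowers = group G for G (structure) +
  fixes p n e :: nat
  assumes finG: "finite (carrier G)" and prime: "prime p" and odd: "odd p"
    and exponent: "\<And>y. y \<in> carrier G \<Longrightarrow> y [^] (p * e) = \<one>"
    and n_eq: "n = card (non_kth_powers G p)"
    and few: "n * n < 2 * order G"
begin

lemma non_power:
  assumes "y \<in> carrier G" "y [^] e \<noteq> \<one>"
  shows "y \<in> non_kth_powers G p"
  using assms exponent by (auto simp: non_kth_powers_def kth_powers_def nat_pow_pow)

lemma finite_nonpowers: "finite (non_kth_powers G p)"
  using finG by (simp add: non_kth_powers_def)

lemma card_le_n: "A \<subseteq> non_kth_powers G p \<Longrightarrow> card A \<le> n"
  using finite_nonpowers by (simp add: n_eq card_mono)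

lemma square_ne_one:
  assumes "w \<in> carrier G" "w [^] p = \<one>" "w \<noteq> \<one>"
  shows "w \<otimes> w \<noteq> \<one>"
proof
  assume "w \<otimes> w = \<one>"
  hence "w [^] (2::nat) = \<one>" using assms by (simp add: numeral_2_eq_2)
  moreover have "coprime p 2" using odd by simp
  ultimately show False using pow_coprime_eq_one assms by blast
qed

text \<open>The \<open>e\<close>-th power kills at most a third of \<open>Q\<close>, and the
  remaining elements are nonpowers. \<open>Q\<close> is left general to serve both for a centralizer
  and for a union of three of its cosets.\<close>

lemma card_translates_le:
  assumes Q: "Q \<subseteq> carrier G" and x: "x \<in> carrier G" "x [^] e \<noteq> \<one>"
    and cl: "\<And>h. h \<in> Q \<Longrightarrow> h \<otimes> x \<in> Q"
    and pw: "\<And>h. h \<in> Q \<Longrightarrow> (h \<otimes> x) [^] e = h [^] e \<otimes> x [^] e"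
  shows "2 * card Q \<le> 3 * n"
proof -
  have fQ: "finite Q" using Q finG finite_subset by blast
  have "(x [^] e) [^] p = \<one>" using exponent x by (simp add: nat_pow_pow mult.commute)
  hence "x [^] e \<otimes> x [^] e \<noteq> \<one>" using square_ne_one x by simp
  hence "3 * card {h \<in> Q. h [^] e = \<one>} \<le> card Q"
    using three_translates fQ Q x cl pw by blast
  moreover have "card {h \<in> Q. h [^] e \<noteq> \<one>} \<le> n"
    using Q non_power by (intro card_le_n) auto
  moreover have "card Q = card {h \<in> Q. h [^] e = \<one>} + card {h \<in> Q. h [^] e \<noteq> \<one>}"
    using fQ by (subst card_Un_disjoint[symmetric]) (auto intro!: arg_cong[where f = card])
  ultimately show ?thesis by linarith
qed

lemma card_centralizer_le:
  assumes x: "x \<in> carrier G" "x [^] e \<noteq> \<one>"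
  shows "2 * card (centralizer x) \<le> 3 * n"
proof (rule card_translates_le[OF centralizer_subset x])
  fix h assume h: "h \<in> centralizer x"
  show "h \<otimes> x \<in> centralizer x"
    using h x subgroup_centralizer centralizer_self by (simp add: subgroup.m_closed)
  show "(h \<otimes> x) [^] e = h [^] e \<otimes> x [^] e"
    using h x by (intro pow_mult_distrib) (auto simp: centralizer_def)
qed

lemma conj_class_nonpowers:
  assumes x: "x \<in> carrier G" "x [^] e \<noteq> \<one>"
  shows "conj_class x \<subseteq> non_kth_powers G p"
  using assms by (auto simp: conj_class_def conjugate_eq_one_iff simp flip: conjugate_pow intro!: non_power)

lemma card_conj_class_gt:
  assumes x: "x \<in> carrier G" "x [^] e \<noteq> \<one>"
  shows "n < 3 * card (conj_class x)"
proof -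
  have "n * n < 2 * (card (conj_class x) * card (centralizer x))"
    using few card_conj_class x by simp
  also have "\<dots> = card (conj_class x) * (2 * card (centralizer x))" by simp
  also have "\<dots> \<le> card (conj_class x) * (3 * n)"
    using card_centralizer_le[OF x] by (intro mult_left_mono) auto
  finally have "n * n < (3 * card (conj_class x)) * n" by (simp add: algebra_simps)
  thus ?thesis by simp
qed

text \<open>The class of \<open>x\<close> consists of nonpowers, so it has at most \<open>n\<close>
  elements; a centralizer with at most \<open>n / 2\<close> elements would contradict
  \<open>few\<close>.\<close>

lemma card_centralizer_gt:
  assumes x: "x \<in> carrier G" "x [^] e \<noteq> \<one>"
  shows "n < 2 * card (centralizer x)"
proof (rule ccontr)
  assume "\<not> n < 2 * card (centralizer x)"
  hence "card (conj_class x) * (2 * card (centralizer x)) \<le> n * n"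
    using card_le_n[OF conj_class_nonpowers[OF x]] by (intro mult_mono) auto
  thus False using few card_conj_class[OF x(1)] by simp
qed

text \<open>By \<open>card_conj_class_gt\<close>, three disjoint classes would hold more than
  \<open>n\<close> nonpowers.\<close>

lemma no_three_classes:
  assumes "x \<in> carrier G" "x [^] e \<noteq> \<one>" "y \<in> carrier G" "y [^] e \<noteq> \<one>"
    "z \<in> carrier G" "z [^] e \<noteq> \<one>" "y \<notin> conj_class x" "z \<notin> conj_class x" "z \<notin> conj_class y"
  shows False
proof -
  have fin: "finite (conj_class u)" for u
    using finG by (simp add: conj_class_def)
  have "(conj_class x \<union> conj_class y) \<inter> conj_class z = {}" "conj_class x \<inter> conj_class y = {}"
    using assms conj_class_disjoint[of x y] conj_class_disjoint[of x z] conj_class_disjoint[of y z] by auto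
  hence "card (conj_class x \<union> conj_class y \<union> conj_class z) = card (conj_class x) + card (conj_class y) + card (conj_class z)"
    using fin by (simp add: card_Un_disjoint)
  moreover have "card (conj_class x \<union> conj_class y \<union> conj_class z) \<le> n"
    using assms conj_class_nonpowers by (intro card_le_n) auto
  ultimately show False
    using card_conj_class_gt[OF assms(1,2)] card_conj_class_gt[OF assms(3,4)] card_conj_class_gt[OF assms(5,6)]
    by linarith
qed

text \<open>The elements taking \<open>x\<close> to \<open>x\<close>, \<open>x \<otimes> k\<close>
  or \<open>x \<otimes> k \<otimes> k\<close> form three cosets of the centralizer. On their union
  the \<open>e\<close>-th power still splits as \<open>card_translates_le\<close> demands, which
  gives \<open>2 * card (centralizer x) \<le> n\<close>, against
  \<open>card_centralizer_gt\<close>.\<close>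

lemma no_central_commutator:
  assumes x: "x \<in> carrier G" "x [^] e \<noteq> \<one>" and pe: "p dvd e"
    and k: "k = x [^] s" "p dvd s" "k [^] p = \<one>" "k \<noteq> \<one>"
    and g: "g \<in> carrier G" "conjugate g x = x \<otimes> k"
  shows False
proof -
  have kG: "k \<in> carrier G" using k x by simp
  have ks: "k [^] s = \<one>" using k kG pow_eq_one_dvd by blast
  have xk: "x \<otimes> k = k \<otimes> x"
    using k x by (simp add: nat_pow_Suc2[symmetric])
  have kj: "x \<otimes> k [^] j = k [^] j \<otimes> x" for j :: nat
    using xk kG x group_commutes_pow[of k x j] by metis
  \<comment> \<open>As \<open>p\<close> divides \<open>s\<close> and
    \<open>k [^] p = \<one>\<close>, multiplying \<open>x\<close> by a power of \<open>k\<close>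
    leaves its \<open>s\<close>-th power, which is \<open>k\<close>, unchanged.\<close>
  have cjk: "conjugate h k = k" if "h \<in> carrier G" "conjugate h x = x \<otimes> k [^] j" for h and j :: nat
  proof -
    have "conjugate h k = (x \<otimes> k [^] j) [^] s" using that x k by (simp add: conjugate_pow)
    also have "\<dots> = x [^] s \<otimes> (k [^] j) [^] s"
      using kj x kG by (intro pow_mult_distrib) auto
    also have "(k [^] j) [^] s = (k [^] s) [^] j"
      using kG by (simp add: nat_pow_pow mult.commute)
    finally show ?thesis using ks k kG x by simp
  qed
  define S where "S j = {h \<in> carrier G. conjugate h x = x \<otimes> k [^] j}" for j :: nat
  define Q where "Q = S 0 \<union> S 1 \<union> S 2"
  have cjg: "conjugate (g [^] j) x = x \<otimes> k [^] j" for j :: nat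
  proof (induction j)
    case (Suc j)
    have "conjugate (g [^] Suc j) x = conjugate (g [^] j) (conjugate g x)"
      using g(1) x by (simp add: conjugate_conjugate)
    also have "\<dots> = x \<otimes> k [^] j \<otimes> k"
      using g x kG Suc cjk by (simp add: conjugate_mult)
    finally show ?case using x kG by (simp add: m_assoc)
  qed (use x in simp)
  have card_S: "card (S j) \<ge> card (centralizer x)" for j
  proof (rule card_inj_on_le)
    show "inj_on (\<lambda>c. g [^] j \<otimes> c) (centralizer x)"
      using g centralizer_subset by (intro inj_onI) (metis Units_eq Units_l_cancel nat_pow_closed subsetD)
    show "(\<lambda>c. g [^] j \<otimes> c) ` centralizer x \<subseteq> S j"
    proof
      fix h assume "h \<in> (\<lambda>c. g [^] j \<otimes> c) ` centralizer x"
      then obtain c where c: "c \<in> centralizer x" "h = g [^] j \<otimes> c" by blast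
      hence "c \<in> carrier G" "conjugate c x = x" using centralizer_subset conjugate_eq_self_iff x by blast+
      thus "h \<in> S j" using c g x cjg by (simp add: S_def flip: conjugate_conjugate)
    qed
    show "finite (S j)" using finG by (simp add: S_def)
  qed
  \<comment> \<open>Oddness of \<open>p\<close> makes \<open>\<one>\<close>, \<open>k\<close> and
    \<open>k [^] 2\<close> distinct, so the three cosets are disjoint.\<close>
  have k2: "k [^] (2::nat) \<noteq> \<one>"
    using square_ne_one[OF kG] k kG by (simp add: numeral_2_eq_2)
  have "k [^] (2::nat) \<noteq> k"
    using k kG by (simp add: numeral_2_eq_2)
  hence disj: "S 0 \<inter> S 1 = {}" "(S 0 \<union> S 1) \<inter> S 2 = {}"
    using k kG x k2 by (auto simp: S_def)
  have "card Q = card (S 0) + card (S 1) + card (S 2)"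
    unfolding Q_def using disj finG by (simp add: S_def card_Un_disjoint)
  hence Q3: "3 * card (centralizer x) \<le> card Q"
    using card_S[of 0] card_S[of 1] card_S[of 2] by linarith
  have "2 * card Q \<le> 3 * n"
  proof (rule card_translates_le[OF _ x])
    show "Q \<subseteq> carrier G" by (auto simp: Q_def S_def)
    fix h assume "h \<in> Q"
    then obtain j :: nat where j: "h \<in> carrier G" "conjugate h x = x \<otimes> k [^] j" "j \<in> {0,1,2}"
      unfolding Q_def S_def by blast
    have "conjugate (h \<otimes> x) x = x \<otimes> k [^] j"
      using j x conjugate_eq_self_iff[of x x] centralizer_self by (simp flip: conjugate_conjugate)
    thus "h \<otimes> x \<in> Q" using j x by (auto simp: Q_def S_def)
    \<comment> \<open>The commutator of \<open>x\<close> and \<open>h\<close>, normalized by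
      \<open>x \<otimes> h = h \<otimes> x \<otimes> l\<close>.\<close>
    define l where "l = inv (k [^] j)"
    have l: "l \<in> carrier G" "x \<otimes> l = l \<otimes> x" "h \<otimes> l = l \<otimes> h"
    proof -
      show lG: "l \<in> carrier G" using kG by (simp add: l_def)
      have "x \<in> centralizer (k [^] j)" using kj x by (simp add: centralizer_def)
      hence "conjugate x (k [^] j) = k [^] j" using x kG conjugate_eq_self_iff by simp
      hence "conjugate x l = l" using x kG by (simp add: l_def conjugate_inv)
      thus "x \<otimes> l = l \<otimes> x" using x lG by (simp add: conjugate_eq_self_iff centralizer_def)
      have "conjugate h l = l" using cjk[OF j(1,2)] j kG by (simp add: l_def conjugate_inv conjugate_pow)
      thus "h \<otimes> l = l \<otimes> h" using j lG by (simp add: conjugate_eq_self_iff centralizer_def)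
    qed
    have "h \<otimes> x = x \<otimes> k [^] j \<otimes> h"
      using j x kG by (metis conjugate_def inv_solve_right' m_closed nat_pow_closed)
    hence "h \<otimes> x \<otimes> l = k [^] j \<otimes> (x \<otimes> h) \<otimes> l"
      using kj x j kG by (simp add: m_assoc[symmetric])
    also have "\<dots> = k [^] j \<otimes> l \<otimes> (x \<otimes> h)"
      using l x j kG by (simp add: m_assoc) (simp add: m_assoc[symmetric])
    also have "\<dots> = x \<otimes> h" using x j kG by (simp add: l_def)
    finally have "(h \<otimes> x) [^] e = h [^] e \<otimes> x [^] e \<otimes> l [^] (e * (e - 1) div 2)"
      using l x j by (intro pow_mult_central_commutator) auto
    \<comment> \<open>The \<open>p\<close>-th power of \<open>l\<close> is trivial, and the odd
      prime \<open>p\<close> still divides \<open>e * (e - 1) div 2\<close>, because it divides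
      \<open>e\<close>.\<close>
    moreover have "l [^] (e * (e - 1) div 2) = \<one>"
    proof (rule pow_eq_one_dvd[OF l(1)])
      have "(k [^] j) [^] p = (k [^] p) [^] j"
        using kG by (simp add: nat_pow_pow mult.commute)
      thus "l [^] p = \<one>" using kG k by (simp add: l_def nat_pow_inv)
      have "even (e * (e - 1))" by (cases e) auto
      hence "2 * (e * (e - 1) div 2) = e * (e - 1)" by (rule dvd_mult_div_cancel)
      hence "p dvd 2 * (e * (e - 1) div 2)"
        using pe by (metis dvd_mult2)
      moreover have "coprime p 2" using odd by simp
      ultimately show "p dvd e * (e - 1) div 2"
        by (simp add: coprime_dvd_mult_right_iff)
    qed
    ultimately show "(h \<otimes> x) [^] e = h [^] e \<otimes> x [^] e"
      using x j by simp
  qed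
  thus False using Q3 card_centralizer_gt[OF x] by linarith
qed

text \<open>With \<open>v = x [^] (p ^ a)\<close> of order \<open>p\<close>, the elements
  \<open>x\<close>, \<open>x \<otimes> v\<close> and \<open>x \<otimes> (v \<otimes> v)\<close> have
  the same \<open>e\<close>-th power, as \<open>p\<close> divides \<open>e\<close>. So
  \<open>no_three_classes\<close> makes two of them conjugate, while
  \<open>no_central_commutator\<close> excludes each pair.\<close>

lemma not_p_dvd_e:
  assumes e: "e = p ^ a * m" and a: "a > 0"
    and x: "x \<in> carrier G" "x [^] e \<noteq> \<one>" "x [^] (p ^ Suc a) = \<one>"
  shows False
proof -
  define v where "v = x [^] (p ^ a)"
  have v: "v \<in> carrier G" "v [^] p = \<one>" "v \<noteq> \<one>"
  proof -
    show "v \<in> carrier G" "v [^] p = \<one>"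
      using x by (simp_all add: v_def nat_pow_pow mult.commute)
    have "x [^] e = v [^] m" using x e by (simp add: v_def nat_pow_pow)
    thus "v \<noteq> \<one>" using x by auto
  qed
  have pa: "p dvd p ^ a" "p dvd e" using a e by (auto simp: dvd_power)
  have vpow: "v [^] s = \<one>" if "p dvd s" for s
    using that v pow_eq_one_dvd by blast
  have v2: "v \<otimes> v \<noteq> \<one>" "v \<otimes> v = x [^] (2 * p ^ a)" "(v \<otimes> v) [^] p = \<one>"
    using v square_ne_one by (simp_all add: pow_mult_distrib) (simp add: v_def nat_pow_mult mult_2 x)
  have xv: "x \<otimes> v = v \<otimes> x" 
    using x by (simp add: v_def nat_pow_Suc2[symmetric])
  have pw1: "(x \<otimes> v) [^] s = x [^] s" if "p dvd s" for s
    using x v xv vpow[OF that] by (simp add: pow_mult_distrib)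
  have pw2: "(x \<otimes> (v \<otimes> v)) [^] s = x [^] s" if "p dvd s" for s
  proof -
    have "x \<otimes> (v \<otimes> v) = v \<otimes> v \<otimes> x" using x v xv by (metis m_assoc)
    thus ?thesis using x v vpow[OF that] by (simp add: pow_mult_distrib)
  qed
  have 1: False if "g \<in> carrier G" "conjugate g x = x \<otimes> v" for g
    using no_central_commutator[OF x(1,2) pa(2) v_def pa(1) v(2,3) that] .
  have "x \<otimes> v \<notin> conj_class x"
    using 1 unfolding conj_class_def by (metis (no_types, lifting) imageE)
  moreover have "x \<otimes> (v \<otimes> v) \<notin> conj_class x"
    using no_central_commutator[OF x(1,2) pa(2) v2(2) _ v2(3,1)] pa(1)
    unfolding conj_class_def by (metis (no_types, lifting) dvd_mult imageE)
  moreover have "x \<otimes> (v \<otimes> v) \<notin> conj_class (x \<otimes> v)"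
  proof
    assume "x \<otimes> (v \<otimes> v) \<in> conj_class (x \<otimes> v)"
    then obtain g where g: "g \<in> carrier G" "conjugate g (x \<otimes> v) = x \<otimes> (v \<otimes> v)"
      by (auto simp: conj_class_def)
    \<comment> \<open>The \<open>p ^ a\<close>-th power of both elements is \<open>v\<close>, so
      \<open>g\<close> commutes with \<open>v\<close>; cancelling \<open>v\<close> reduces this pair
      to the first one.\<close>
    have "conjugate g ((x \<otimes> v) [^] (p ^ a)) = (x \<otimes> (v \<otimes> v)) [^] (p ^ a)"
      using g x v by (simp add: conjugate_pow)
    hence "conjugate g v = v" using pw1[OF pa(1)] pw2[OF pa(1)] by (simp add: v_def)
    hence "conjugate g x \<otimes> v = x \<otimes> v \<otimes> v"
      using g x v by (simp add: conjugate_mult m_assoc)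
    hence "conjugate g x = x \<otimes> v" using g x v by simp
    thus False using 1 g by blast
  qed
  ultimately show False
    using no_three_classes[of x "x \<otimes> v" "x \<otimes> (v \<otimes> v)"] x v pw1 pw2 pa by auto
qed

end

section \<open>Involutions acting without fixed points\<close>

context group
begin

lemma centralizer_inv:
  assumes "x \<in> carrier G"
  shows "centralizer (inv x) = centralizer x"
proof -
  have *: "centralizer x \<subseteq> centralizer (inv x)" if x: "x \<in> carrier G" for x
  proof
    fix g assume g: "g \<in> centralizer x"
    hence "g \<in> carrier G" "conjugate g x = x"
      using x conjugate_eq_self_iff centralizer_subset by blast+
    thus "g \<in> centralizer (inv x)"
      using x by (simp add: conjugate_inv flip: conjugate_eq_self_iff)
  qed
  show ?thesis using *[of x] *[of "inv x"] assms by auto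
qed

text \<open>Without nontrivial fixed points the map
  \<open>y \<mapsto> inv y \<otimes> conjugate t y\<close> is injective, hence onto
  \<open>P\<close>, and conjugation by \<open>t\<close> inverts each of its values. A group on which
  inversion is a homomorphism is abelian.\<close>

lemma fixed_point_free_involution_abelian:
  assumes P: "subgroup P G" "finite P" and t: "t \<in> carrier G" "t \<otimes> t = \<one>"
    and inv: "\<And>y. y \<in> P \<Longrightarrow> conjugate t y \<in> P"
    and fpf: "\<And>y. y \<in> P \<Longrightarrow> conjugate t y = y \<Longrightarrow> y = \<one>"
    and ab: "a \<in> P" "b \<in> P"
  shows "a \<otimes> b = b \<otimes> a"
proof -
  interpret P: subgroup P G by (rule P)
  have PG: "u \<in> carrier G" if "u \<in> P" for u
    using that P.subset by blast
  have tt: "conjugate t (conjugate t u) = u" if "u \<in> P" for u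
    using that PG t by (simp add: conjugate_conjugate)
  define f where "f y = inv y \<otimes> conjugate t y" for y
  have "inj_on f P"
  proof (rule inj_onI)
    fix y z assume yz: "y \<in> P" "z \<in> P" "f y = f z"
    have "z \<otimes> f y \<otimes> inv (conjugate t y) = z \<otimes> f z \<otimes> inv (conjugate t y)"
      using yz by simp
    hence "z \<otimes> inv y = conjugate t z \<otimes> inv (conjugate t y)"
      using yz PG t by (simp add: f_def m_assoc)
    hence "conjugate t (z \<otimes> inv y) = z \<otimes> inv y"
      using yz PG t tt by (simp add: conjugate_mult conjugate_inv)
    hence "z \<otimes> inv y = \<one>" using fpf yz by simp
    thus "y = z" using yz PG by (simp add: mult_inv_eq_one_iff)
  qed
  moreover have "f ` P \<subseteq> P" using inv by (auto simp: f_def)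
  ultimately have surj: "f ` P = P" using P by (intro endo_inj_surj)
  have cjt: "conjugate t w = inv w" if w: "w \<in> P" for w
  proof -
    obtain y where y: "y \<in> P" "w = f y" using surj w by blast
    thus ?thesis using PG t tt by (simp add: f_def conjugate_mult conjugate_inv inv_mult_group)
  qed
  have "inv (a \<otimes> b) = inv (b \<otimes> a)"
  proof -
    have "inv (a \<otimes> b) = conjugate t (a \<otimes> b)" using cjt ab by simp
    also have "\<dots> = inv a \<otimes> inv b" using ab PG t by (simp add: conjugate_mult cjt)
    also have "\<dots> = inv (b \<otimes> a)" using ab PG by (simp add: inv_mult_group)
    finally show ?thesis .
  qed
  thus ?thesis using ab PG by (metis inv_inv m_closed)
qed

end

section \<open>Nonpowers as products of elements of order \<open>p\<close> and
  \<open>p\<close>-regular elements\<close>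

locale few_nonpowers_coprime = few_nonpowers +
  assumes cop: "coprime p e"
begin

definition order_p where "order_p = {u \<in> carrier G. u [^] p = \<one> \<and> u \<noteq> \<one>}"

text \<open>Since \<open>p * e\<close> is an exponent and \<open>e\<close> is prime to
  \<open>p\<close>, the condition \<open>w [^] e = \<one>\<close> says that the order of
  \<open>w\<close> is prime to \<open>p\<close>.\<close>

definition regular_centralizer where "regular_centralizer u = {w \<in> centralizer u. w [^] e = \<one>}"

abbreviation "N \<equiv> non_kth_powers G p"

text \<open>If \<open>y [^] e = \<one>\<close> and \<open>p * i = e * j + 1\<close>, then
  \<open>y\<close> is the \<open>p\<close>-th power of \<open>y [^] i\<close>.\<close>

lemma N_eq: "N = {y \<in> carrier G. y [^] e \<noteq> \<one>}"
proof
  show "{y \<in> carrier G. y [^] e \<noteq> \<one>} \<subseteq> N" using non_power by auto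
  show "N \<subseteq> {y \<in> carrier G. y [^] e \<noteq> \<one>}"
  proof
    fix y assume y: "y \<in> N"
    hence yG: "y \<in> carrier G" by (simp add: non_kth_powers_def)
    have "y [^] e \<noteq> \<one>"
    proof
      assume e: "y [^] e = \<one>"
      obtain i j where ij: "p * i = e * j + 1"
        using bezout_nat[of p e] prime cop by (auto simp: coprime_iff_gcd_eq_1)
      have "(y [^] i) [^] p = y [^] (e * j) \<otimes> y"
        using yG ij by (simp add: nat_pow_pow mult.commute)
      also have "y [^] (e * j) = \<one>" using e yG by (simp flip: nat_pow_pow)
      finally have "y \<in> kth_powers G p"
        using yG by (auto simp: kth_powers_def intro!: image_eqI[of _ _ "y [^] i"])
      thus False using y by (simp add: non_kth_powers_def)
    qed
    thus "y \<in> {y \<in> carrier G. y [^] e \<noteq> \<one>}" using yG by simp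
  qed
qed

lemma one_notin_N: "\<one> \<notin> N"
  by (simp add: N_eq)

lemma order_p_pow: "u \<in> order_p \<Longrightarrow> u \<in> carrier G \<and> u [^] e \<noteq> \<one>"
  using cop pow_coprime_eq_one by (auto simp: order_p_def)

lemma order_p_subset_N: "order_p \<subseteq> N"
  using order_p_pow by (auto simp: N_eq)

lemma order_p_conjugate: "g \<in> carrier G \<Longrightarrow> u \<in> order_p \<Longrightarrow> conjugate g u \<in> order_p"
  by (auto simp: order_p_def conjugate_eq_one_iff simp flip: conjugate_pow)

lemma order_p_inv: "u \<in> order_p \<Longrightarrow> inv u \<in> order_p"
  by (auto simp: order_p_def nat_pow_inv)

lemma inv_ne: "u \<in> order_p \<Longrightarrow> inv u \<noteq> u"
  using square_ne_one by (auto simp: order_p_def) (metis r_inv)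

lemma order_p_conj_class: "x \<in> order_p \<Longrightarrow> conj_class x \<subseteq> order_p"
  using order_p_conjugate by (auto simp: conj_class_def)

lemma finite_order_p: "finite order_p"
  using finG by (simp add: order_p_def)

lemma finite_regular_centralizer: "finite (regular_centralizer u)"
  by (rule finite_subset[OF _ finG]) (auto simp: regular_centralizer_def centralizer_def)

lemma one_in_regular_centralizer: "u \<in> carrier G \<Longrightarrow> \<one> \<in> regular_centralizer u"
  by (simp add: regular_centralizer_def centralizer_def)

lemma regular_centralizer_conjugate: "g \<in> carrier G \<Longrightarrow> u \<in> carrier G \<Longrightarrow> card (regular_centralizer (conjugate g u)) = card (regular_centralizer u)"
proof -
  assume g: "g \<in> carrier G" "u \<in> carrier G"
  have *: "conjugate g w [^] e = \<one> \<longleftrightarrow> w [^] e = \<one>" if "w \<in> centralizer u" for w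
  proof -
    have "w \<in> carrier G" using that centralizer_subset by blast
    thus ?thesis using g by (simp add: conjugate_eq_one_iff flip: conjugate_pow)
  qed
  have "regular_centralizer (conjugate g u) = conjugate g ` regular_centralizer u"
    unfolding regular_centralizer_def centralizer_conjugate[OF g] using * by blast
  moreover have "inj_on (conjugate g) (regular_centralizer u)"
    using conjugate_inj[OF g(1)] centralizer_subset by (auto simp: regular_centralizer_def intro: inj_on_subset)
  ultimately show ?thesis by (simp add: card_image)
qed

text \<open>With \<open>p * i = e * j + 1\<close>, the factors are the powers of \<open>y\<close>
  with exponents \<open>- e * j\<close> and \<open>p * i\<close>; as powers of one element they
  commute.\<close>

lemma N_decompose:
  assumes "y \<in> N"
  obtains u w where "u \<in> order_p" "w \<in> regular_centralizer u" "y = u \<otimes> w"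
proof -
  have y: "y \<in> carrier G" "y [^] e \<noteq> \<one>" using assms by (auto simp: N_eq)
  obtain i j where ij: "p * i = e * j + 1"
    using bezout_nat[of p e] prime cop by (auto simp: coprime_iff_gcd_eq_1)
  define u where "u = inv (y [^] (e * j))"
  define w where "w = y [^] (p * i)"
  have uw: "u \<in> carrier G" "w \<in> carrier G" using y by (auto simp: u_def w_def)
  have "w = y [^] (e * j) \<otimes> y" using y by (simp add: w_def ij)
  hence yu: "y = u \<otimes> w" using y by (simp add: u_def)
  have "y [^] (e * j * p) = \<one>" "y [^] (p * i * e) = \<one>"
    using y exponent pow_eq_one_dvd[of y "p * e"] by (auto intro: mult_dvd_mono)
  hence up: "u [^] p = \<one>" and we: "w [^] e = \<one>"
    using y by (simp_all add: u_def w_def nat_pow_pow nat_pow_inv)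
  have "y [^] (p * i) \<otimes> y [^] (e * j) = y [^] (e * j) \<otimes> y [^] (p * i)"
    using y by (simp add: nat_pow_mult add.commute)
  hence "w \<in> centralizer (y [^] (e * j))" using uw by (simp add: centralizer_def w_def)
  hence "w \<in> centralizer u" using y by (simp add: u_def centralizer_inv)
  moreover have "u \<noteq> \<one>" using yu uw we y by auto
  ultimately show ?thesis
    using that[of u w] uw up we yu by (auto simp: order_p_def regular_centralizer_def)
qed

text \<open>The decomposition of a nonpower is unique: raising \<open>u \<otimes> w\<close> to the
  power \<open>p * i\<close> kills \<open>u\<close> and fixes \<open>w\<close>. So nonpowers
  correspond to pairs.\<close>

lemma n_eq_sum: "n = (\<Sum>u\<in>order_p. card (regular_centralizer u))"
proof -
  have RG: "w \<in> carrier G" "u \<otimes> w = w \<otimes> u" if "w \<in> regular_centralizer u" for u w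
    using that by (auto simp: regular_centralizer_def centralizer_def)
  have pw: "(u \<otimes> w) [^] (s::nat) = u [^] s \<otimes> w [^] s" if "u \<in> order_p" "w \<in> regular_centralizer u" for u w s
    using that RG[OF that(2)] order_p_pow by (intro pow_mult_distrib) auto
  obtain i j where ij: "p * i = e * j + 1"
    using bezout_nat[of p e] prime cop by (auto simp: coprime_iff_gcd_eq_1)
  have w_of: "(u \<otimes> w) [^] (p * i) = w" if uw: "u \<in> order_p" "w \<in> regular_centralizer u" for u w
  proof -
    have "u [^] (p * i) = \<one>" 
      using uw pow_eq_one_dvd[of u p "p * i"] by (simp add: order_p_def)
    moreover have "w [^] (e * j) = \<one>"
      using uw RG[OF uw(2)] pow_eq_one_dvd[of w e "e * j"] by (simp add: regular_centralizer_def)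
    hence "w [^] (p * i) = w" using RG[OF uw(2)] by (simp add: ij)
    ultimately show ?thesis using pw[OF uw] RG[OF uw(2)] by simp
  qed
  have "bij_betw (\<lambda>(u, w). u \<otimes> w) (SIGMA u:order_p. regular_centralizer u) N"
    unfolding bij_betw_def
  proof
    show "inj_on (\<lambda>(u, w). u \<otimes> w) (SIGMA u:order_p. regular_centralizer u)"
    proof (rule inj_onI, clarify)
      fix u w u' w'
      assume *: "u \<in> order_p" "w \<in> regular_centralizer u" "u' \<in> order_p" "w' \<in> regular_centralizer u'" "u \<otimes> w = u' \<otimes> w'"
      hence "w = w'" using w_of by metis
      thus "u = u' \<and> w = w'" using * RG order_p_pow by (metis right_cancel)
    qed
    show "(\<lambda>(u, w). u \<otimes> w) ` (SIGMA u:order_p. regular_centralizer u) = N"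
    proof (intro equalityI subsetI)
      fix y assume "y \<in> (\<lambda>(u, w). u \<otimes> w) ` (SIGMA u:order_p. regular_centralizer u)"
      then obtain u w where uw: "u \<in> order_p" "w \<in> regular_centralizer u" "y = u \<otimes> w" by auto
      thus "y \<in> N"
        using pw[OF uw(1,2)] RG[OF uw(2)] order_p_pow[OF uw(1)] by (simp add: N_eq regular_centralizer_def)
    next
      fix y assume "y \<in> N"
      thus "y \<in> (\<lambda>(u, w). u \<otimes> w) ` (SIGMA u:order_p. regular_centralizer u)"
        by (rule N_decompose) force
    qed
  qed
  hence "card (SIGMA u:order_p. regular_centralizer u) = n"
    using bij_betw_same_card n_eq by metis
  thus ?thesis using finite_order_p finite_regular_centralizer by simp
qed

section \<open>Contributions of conjugacy classes to \<open>n\<close>\<close>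

lemma sum_regular_centralizer_conj_class:
  assumes "x \<in> order_p"
  shows "(\<Sum>u\<in>conj_class x. card (regular_centralizer u)) = card (conj_class x) * card (regular_centralizer x)"
proof -
  have "(\<Sum>u\<in>conj_class x. card (regular_centralizer u)) = (\<Sum>u\<in>conj_class x. card (regular_centralizer x))"
    using assms order_p_pow by (intro sum.cong) (auto simp: conj_class_def regular_centralizer_conjugate)
  thus ?thesis by simp
qed

lemma card_regular_centralizer_pos: "u \<in> order_p \<Longrightarrow> card (regular_centralizer u) \<ge> 1"
  using one_in_regular_centralizer[of u] finite_regular_centralizer[of u] order_p_pow[of u] by (auto simp: Suc_le_eq card_gt_0_iff)

text \<open>The class of \<open>x\<close> contributes its size times
  \<open>card (regular_centralizer x)\<close> to \<open>n\<close>, and its size exceeds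
  \<open>n / 3\<close>.\<close>

lemma card_regular_centralizer_le:
  assumes x: "x \<in> order_p"
  shows "card (regular_centralizer x) \<le> 2"
proof (rule ccontr)
  assume "\<not> card (regular_centralizer x) \<le> 2"
  hence "card (conj_class x) * 3 \<le> (\<Sum>u\<in>conj_class x. card (regular_centralizer u))"
    using sum_regular_centralizer_conj_class[OF x] by simp
  also have "\<dots> \<le> n"
    unfolding n_eq_sum using order_p_conj_class[OF x] finite_order_p by (intro sum_mono2) auto
  finally show False using card_conj_class_gt[of x] order_p_pow[OF x] by simp
qed

text \<open>The class of \<open>x\<close> already contributes more than \<open>2 * n / 3\<close>,
  which leaves no room for a second class.\<close>

lemma card_regular_centralizer_two_single_class:
  assumes x: "x \<in> order_p" "card (regular_centralizer x) = 2"
  shows "order_p = conj_class x"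
proof (rule ccontr)
  assume "order_p \<noteq> conj_class x"
  then obtain y where y: "y \<in> order_p" "y \<notin> conj_class x" using order_p_conj_class[OF x(1)] by blast
  have "conj_class x \<inter> conj_class y = {}"
    using conj_class_disjoint[of x y] x y order_p_pow by blast
  moreover have "finite (conj_class u)" for u using finG by (simp add: conj_class_def)
  ultimately have "card (conj_class x) * 2 + card (conj_class y) * card (regular_centralizer y)
    = (\<Sum>u\<in>conj_class x \<union> conj_class y. card (regular_centralizer u))"
    using sum_regular_centralizer_conj_class x y by (simp add: sum.union_disjoint)
  also have "\<dots> \<le> n"
    unfolding n_eq_sum using order_p_conj_class x y finite_order_p by (intro sum_mono2) auto
  finally have "card (conj_class x) * 2 + card (conj_class y) * card (regular_centralizer y) \<le> n" .
  moreover have "card (conj_class y) * 1 \<le> card (conj_class y) * card (regular_centralizer y)"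
    using card_regular_centralizer_pos[OF y(1)] by (intro mult_left_mono) auto
  ultimately show False
    using card_conj_class_gt[of x] card_conj_class_gt[of y] order_p_pow x y by fastforce
qed

section \<open>The Frobenius cases, with centralizers of exponent \<open>p\<close>\<close>

lemma two_le_n: "x \<in> order_p \<Longrightarrow> 2 \<le> n"
  using card_le_n[of "{x, inv x}"] order_p_subset_N order_p_inv[of x] inv_ne[of x] by fastforce

text \<open>The common end of (1) and (3). The kernel \<open>insert \<one> N\<close> is a subgroup
  because it is a centralizer, and normal because \<open>N\<close> is closed under conjugation. Its
  index is \<open>m\<close>; for \<open>m = 1\<close> it is the whole group and the complement
  degenerates.\<close>

lemma frobenius_with_kernel:
  assumes x: "x \<in> N" and centralizer: "\<And>u. u \<in> N \<Longrightarrow> centralizer u = insert \<one> N"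
    and card: "n = k * m" "order G = (n + 1) * m"
  shows "\<exists>H. (frobenius_complement G H \<or> m = 1 \<and> H = {\<one>}) \<and>
    card (frobenius_kernel G H) = n + 1 \<and> N = frobenius_kernel G H - {\<one>}"
proof -
  let ?P = "insert \<one> N"
  have sub: "subgroup ?P G"
    using subgroup_centralizer[of x] centralizer[OF x] x by (simp add: N_eq)
  have P: "?P \<lhd> G"
    unfolding normal_inv_iff
  proof (intro conjI ballI sub)
    fix g h assume g: "g \<in> carrier G" "h \<in> ?P"
    hence "conjugate g h \<in> ?P"
      by (auto simp: N_eq conjugate_eq_one_iff simp flip: conjugate_pow)
    thus "g \<otimes> h \<otimes> inv g \<in> ?P" by (simp add: conjugate_def)
  qed
  have cP: "card ?P = n + 1"
    using one_notin_N finite_nonpowers n_eq by simp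
  obtain H where H: "subgroup H G" "H \<inter> ?P = {\<one>}" "frobenius_kernel G H = ?P"
    "?P \<noteq> {\<one>} \<Longrightarrow> ?P \<noteq> carrier G \<Longrightarrow> frobenius_complement G H"
  proof (rule self_centralizing_frobenius[OF P finG])
    show "centralizer u = ?P" if "u \<in> ?P" "u \<noteq> \<one>" for u using that centralizer by blast
    show "card ?P = k * m + 1" "order G = card ?P * m" using cP card by auto
  qed blast
  have "frobenius_complement G H \<or> m = 1 \<and> H = {\<one>}"
  proof (cases "?P = carrier G")
    case True
    hence "H = {\<one>}" using H(1,2) subgroup.subset by blast
    moreover have "(n + 1) * m = n + 1" using card(2) cP True by (simp add: order_def)
    hence "m = 1" by (metis add_is_0 mult.right_neutral mult_cancel1 one_neq_zero)
    ultimately show ?thesis by simp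
  next
    case False
    have "?P \<noteq> {\<one>}" using x one_notin_N by blast
    thus ?thesis using H False by blast
  qed
  moreover have "N = frobenius_kernel G H - {\<one>}" using H(3) one_notin_N by auto
  ultimately show ?thesis using H(3) cP by metis
qed

text \<open>The power \<open>w [^] p\<close> lies in \<open>regular_centralizer u\<close>, whose
  only element is \<open>\<one>\<close>.\<close>

lemma centralizer_pow_p:
  assumes "u \<in> order_p" "card (regular_centralizer u) = 1" "w \<in> centralizer u"
  shows "w [^] p = \<one>"
proof -
  have "subgroup (centralizer u) G" using assms order_p_pow subgroup_centralizer by blast
  hence *: "w [^] s \<in> centralizer u" for s :: nat
    using assms(3) by (induction s) (auto simp: subgroup.m_closed subgroup.one_closed)
  have w: "w \<in> carrier G" using assms centralizer_subset by blast
  hence "w [^] p \<in> regular_centralizer u" using * exponent by (simp add: regular_centralizer_def nat_pow_pow)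
  moreover obtain v where "regular_centralizer u = {v}" using assms(2) card_1_singletonE by blast
  ultimately show ?thesis using one_in_regular_centralizer[of u] order_p_pow[OF assms(1)] by auto
qed

lemma N_eq_order_p:
  assumes "\<And>u. u \<in> order_p \<Longrightarrow> card (regular_centralizer u) = 1"
  shows "N = order_p"
proof -
  have "card N = card order_p" using n_eq_sum assms n_eq by simp
  thus ?thesis using order_p_subset_N finite_nonpowers by (metis card_subset_eq)
qed

text \<open>The single class makes \<open>x\<close> conjugate to its inverse, and an odd power of
  the conjugating element is an involution. It fixes no \<open>y \<noteq> \<one>\<close> in
  \<open>centralizer x\<close>, since such a \<open>y\<close> has order \<open>p\<close> and its
  centralizer has exponent \<open>p\<close>.\<close>

lemma single_class_abelian_centralizer:
  assumes x: "x \<in> order_p" and cl: "order_p = conj_class x" and R1: "\<And>u. u \<in> order_p \<Longrightarrow> card (regular_centralizer u) = 1"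
    and ab: "a \<in> centralizer x" "b \<in> centralizer x"
  shows "a \<otimes> b = b \<otimes> a"
proof -
  have xG: "x \<in> carrier G" using x order_p_pow by blast
  obtain g where g: "g \<in> carrier G" "conjugate g x = inv x"
    using order_p_inv[OF x] by (auto simp: cl conj_class_def)
  have "conjugate (g \<otimes> g) x = x"
    using g xG by (simp add: conjugate_inv flip: conjugate_conjugate)
  hence gg: "g \<otimes> g \<in> centralizer x" using g xG by (simp add: conjugate_eq_self_iff)
  hence gp: "(g \<otimes> g) [^] p = \<one>" using centralizer_pow_p x R1 by blast
  obtain q where q: "p = 2 * q + 1" using odd oddE by blast
  \<comment> \<open>An involution that inverts \<open>x\<close>; it acts without fixed points on \<open>C(x)\<close>.\<close>
  define t where "t = g [^] p"
  have tG: "t \<in> carrier G" using g by (simp add: t_def)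
  have tt: "t \<otimes> t = \<one>" using gp g by (simp add: t_def pow_mult_distrib)
  \<comment> \<open>As \<open>p\<close> is odd, \<open>t\<close> is \<open>g\<close> up to a power
    of \<open>g \<otimes> g\<close>, which centralizes \<open>x\<close>; so \<open>t\<close> inverts
    \<open>x\<close> as \<open>g\<close> does.\<close>
  have "t = (g \<otimes> g) [^] q \<otimes> g"
    using g by (simp add: t_def q pow_mult_distrib nat_pow_mult mult_2)
  moreover have "conjugate ((g \<otimes> g) [^] q) x = x"
  proof -
    have "subgroup (centralizer x) G" using xG by (rule subgroup_centralizer)
    hence "(g \<otimes> g) [^] q \<in> centralizer x"
      using gg by (induction q) (auto simp: subgroup.m_closed subgroup.one_closed)
    thus ?thesis using g xG by (simp add: conjugate_eq_self_iff)
  qed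
  ultimately have tx: "conjugate t x = inv x"
    using g xG by (simp add: conjugate_inv flip: conjugate_conjugate)
  show ?thesis
  proof (rule fixed_point_free_involution_abelian[OF _ _ tG tt _ _ ab])
    show "subgroup (centralizer x) G" using xG by (rule subgroup_centralizer)
    show "finite (centralizer x)" using finG centralizer_subset finite_subset by blast
    show "conjugate t y \<in> centralizer x" if "y \<in> centralizer x" for y
      using that centralizer_conjugate[OF tG xG] xG by (auto simp: tx centralizer_inv)
    show "y = \<one>" if y: "y \<in> centralizer x" "conjugate t y = y" for y
    proof (rule ccontr)
      assume "y \<noteq> \<one>"
      have yG: "y \<in> carrier G" using y centralizer_subset by blast
      have "y \<in> order_p"
        using centralizer_pow_p[OF x] R1 x y yG \<open>y \<noteq> \<one>\<close> by (auto simp: order_p_def)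
      moreover have "t \<in> centralizer y" using y yG tG by (simp add: conjugate_eq_self_iff)
      ultimately have "t [^] p = \<one>" using centralizer_pow_p R1 by blast
      hence "t = \<one>" using square_ne_one tG tt by blast
      thus False using tx xG inv_ne[OF x] by simp
    qed
  qed
qed

text \<open>Every nonidentity element of \<open>centralizer x\<close> is conjugate to
  \<open>x\<close> and has the same centralizer. Once all of \<open>order_p\<close> is seen to lie
  there, the class and the centralizer of \<open>x\<close> have \<open>n\<close> and
  \<open>n + 1\<close> elements.\<close>

lemma single_class:
  assumes x: "x \<in> order_p" and cl: "order_p = conj_class x" and R1: "\<And>u. u \<in> order_p \<Longrightarrow> card (regular_centralizer u) = 1"
  shows "order G = n * (n + 1)"
    and "\<exists>H. frobenius_complement G H \<and> card (frobenius_kernel G H) = n + 1 \<and>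
      N = frobenius_kernel G H - {\<one>}"
proof -
  have NE: "N = order_p" using N_eq_order_p R1 by blast
  have xG: "x \<in> carrier G" using x order_p_pow by blast
  let ?P = "centralizer x"
  have P: "subgroup ?P G" using xG by (rule subgroup_centralizer)
  interpret P: subgroup ?P G by (rule P)
  have finP: "finite ?P" using finG centralizer_subset finite_subset by blast
  have PE: "u \<in> order_p" if "u \<in> ?P" "u \<noteq> \<one>" for u
    using centralizer_pow_p[OF x] R1 x that centralizer_subset by (auto simp: order_p_def)
  \<comment> \<open>Commutativity gives one inclusion, and conjugacy of \<open>u\<close> to
    \<open>x\<close> the equality of orders.\<close>
  have centralizer: "centralizer u = ?P" if u: "u \<in> ?P" "u \<noteq> \<one>" for u
  proof -
    have uG: "u \<in> carrier G" using u centralizer_subset by blast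
    have "?P \<subseteq> centralizer u"
    proof
      fix v assume v: "v \<in> ?P"
      have "v \<otimes> u = u \<otimes> v"
        by (rule single_class_abelian_centralizer[OF x cl R1 v u(1)])
      moreover have "v \<in> carrier G" using v centralizer_subset by blast
      ultimately show "v \<in> centralizer u" unfolding centralizer_def by blast
    qed
    moreover have "card (centralizer u) = card ?P"
    proof -
      have "u \<in> conj_class x" using PE[OF u] cl by blast
      thus ?thesis using card_centralizer_conjugate[OF _ xG] by (auto simp: conj_class_def)
    qed
    moreover have "finite (centralizer u)" using finG centralizer_subset finite_subset by blast
    ultimately show ?thesis by (metis card_subset_eq)
  qed
  \<comment> \<open>An element outside \<open>C(x)\<close> and its inverse would have disjoint regular orbits under \<open>C(x)\<close>,
      hence \<open>2 |C(x)| \<le> n\<close>.\<close>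
  have EP: "order_p \<subseteq> ?P"
  proof (rule subsetI, rule ccontr)
    fix y assume y: "y \<in> order_p" "y \<notin> ?P"
    have yG: "y \<in> carrier G" using y order_p_pow by blast
    have iy: "inv y \<in> carrier G" "inv y \<notin> ?P" 
      using y yG by auto (metis P.m_inv_closed inv_inv)
    have free: "u = \<one>" if "u \<in> ?P" "z \<notin> ?P" "u \<in> centralizer z" "z \<in> carrier G" for u z
      using centralizer[of u] centralizer_sym[of z u] that by blast
    have inj: "inj_on (\<lambda>u. conjugate u z) ?P" if z: "z \<in> carrier G" "z \<notin> ?P" for z
    proof (rule inj_onI)
      fix u v assume uv: "u \<in> ?P" "v \<in> ?P" "conjugate u z = conjugate v z"
      have "conjugate (inv v \<otimes> u) z = z"
        using uv z by (simp flip: conjugate_conjugate)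
      hence "inv v \<otimes> u = \<one>"
        using free[of "inv v \<otimes> u" z] uv z by (simp add: conjugate_eq_self_iff)
      thus "u = v" using uv by (simp add: inv_mult_eq_one_iff)
    qed
    let ?A = "(\<lambda>u. conjugate u y) ` ?P" and ?B = "(\<lambda>u. conjugate u (inv y)) ` ?P"
    \<comment> \<open>A common element yields \<open>w\<close> in \<open>?P\<close> inverting
      \<open>y\<close>. Then \<open>w \<otimes> w\<close> fixes \<open>y\<close>, hence is trivial,
      and so is \<open>w\<close> because its \<open>p\<close>-th power is trivial too; but
      \<open>y\<close> is not its own inverse.\<close>
    have "?A \<inter> ?B = {}"
    proof (rule ccontr)
      assume "?A \<inter> ?B \<noteq> {}"
      then obtain u v where uv: "u \<in> ?P" "v \<in> ?P" "conjugate u y = conjugate v (inv y)" by blast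
      define w where "w = inv v \<otimes> u"
      have w: "w \<in> ?P" "w \<in> carrier G" using uv by (auto simp: w_def)
      have "conjugate w y = inv y" using uv yG by (simp add: w_def flip: conjugate_conjugate)
      moreover from this have "conjugate (w \<otimes> w) y = y"
        using w yG by (simp add: conjugate_inv flip: conjugate_conjugate)
      hence "w \<otimes> w = \<one>"
        using free[of "w \<otimes> w" y] w y yG by (simp add: conjugate_eq_self_iff)
      hence "w = \<one>" using square_ne_one w centralizer_pow_p[OF x] R1 x by blast
      ultimately show False using yG inv_ne[OF y(1)] by simp
    qed
    hence "card (?A \<union> ?B) = card ?A + card ?B"
      using finP by (intro card_Un_disjoint) auto
    also have "\<dots> = 2 * card ?P"
      using inj[OF yG y(2)] inj[OF iy] by (simp add: card_image)
    finally have "2 * card ?P = card (?A \<union> ?B)" ..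
    also have "\<dots> \<le> n"
      using y order_p_inv order_p_conjugate order_p_subset_N by (intro card_le_n) auto
    finally show False using card_centralizer_gt[of x] order_p_pow[OF x] by simp
  qed
  have PN: "?P = insert \<one> N" using PE EP NE P.one_closed by blast
  have cP: "card ?P = n + 1"
    unfolding PN using one_notin_N finite_nonpowers n_eq by simp
  have cx: "card (conj_class x) = n" using n_eq NE cl by simp
  show ord: "order G = n * (n + 1)"
    using card_conj_class[OF xG] cP cx by simp
  have "\<exists>H. (frobenius_complement G H \<or> n = 1 \<and> H = {\<one>}) \<and>
    card (frobenius_kernel G H) = n + 1 \<and> N = frobenius_kernel G H - {\<one>}"
  proof (rule frobenius_with_kernel[where k = 1])
    show "x \<in> N" using x NE by simp
    show "centralizer u = insert \<one> N" if "u \<in> N" for u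
      using that centralizer[of u] PN one_notin_N by blast
  qed (use ord in auto)
  thus "\<exists>H. frobenius_complement G H \<and> card (frobenius_kernel G H) = n + 1 \<and>
      N = frobenius_kernel G H - {\<one>}"
    using two_le_n[OF x] by auto
qed

text \<open>The hypothesis \<open>le\<close> singles out the centralizer, that of \<open>y\<close>,
  which fills \<open>insert \<one> N\<close>: it lies in this set and has more than \<open>n\<close>
  elements. Divisibility and an estimate of \<open>3 * order G\<close> then make the two
  centralizers equal.\<close>

lemma two_classes:
  assumes x: "x \<in> order_p" and y: "y \<in> order_p" "y \<notin> conj_class x"
    and R1: "\<And>u. u \<in> order_p \<Longrightarrow> card (regular_centralizer u) = 1"
    and le: "card (centralizer x) \<le> card (centralizer y)"
  shows "2 * order G = n * (n + 1)"
    and "\<exists>H. (frobenius_complement G H \<or> order G = 3 \<and> H = {\<one>}) \<and>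
      card (frobenius_kernel G H) = n + 1 \<and> N = frobenius_kernel G H - {\<one>}"
proof -
  have NE: "N = order_p" using N_eq_order_p R1 by blast
  have xG: "x \<in> carrier G" "x [^] e \<noteq> \<one>" and yG: "y \<in> carrier G" "y [^] e \<noteq> \<one>"
    using x y order_p_pow by blast+
  have "order_p \<subseteq> conj_class x \<union> conj_class y"
    using no_three_classes[OF xG yG] y order_p_pow by blast
  hence E: "order_p = conj_class x \<union> conj_class y" using order_p_conj_class x y by blast
  have "finite (conj_class u)" for u using finG by (simp add: conj_class_def)
  hence n: "n = card (conj_class x) + card (conj_class y)"
    using n_eq NE E conj_class_disjoint[OF xG(1) yG(1) y(2)] by (simp add: card_Un_disjoint)
  have fin: "finite (centralizer u)" for u using finG centralizer_subset finite_subset by blast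
  define c d where "c = card (centralizer x)" and "d = card (centralizer y)"
  have ox: "order G = card (conj_class x) * c" and oy: "order G = card (conj_class y) * d"
    using card_conj_class xG yG by (simp_all add: c_def d_def)
  let ?P = "centralizer y"
  have sP: "subgroup ?P G" and sx: "subgroup (centralizer x) G"
    using xG yG subgroup_centralizer by blast+
  have oneP: "\<one> \<in> ?P" using sP by (rule subgroup.one_closed)
  have sub: "centralizer u \<subseteq> insert \<one> N" if "u \<in> order_p" for u
    using centralizer_pow_p[OF that R1[OF that]] centralizer_subset by (auto simp: NE order_p_def)
  have cN: "card (insert \<one> N) = n + 1"
    using one_notin_N finite_nonpowers n_eq by simp
  have "d \<le> n + 1"
    unfolding d_def using card_mono[OF _ sub[OF y(1)]] cN finite_nonpowers by simp
  moreover have "n < d"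
  proof -
    \<comment> \<open>The order of \<open>G\<close> is evaluated once through each class, and the
      class sizes add up to \<open>n\<close>.\<close>
    have "2 * order G \<le> n * d"
      using le mult_left_mono[of c d "card (conj_class x)"] ox oy
      by (simp add: n c_def d_def add_mult_distrib)
    hence "n * n < n * d" using few by linarith
    thus ?thesis by simp
  qed
  ultimately have d: "d = n + 1" by simp
  have PN: "?P = insert \<one> N"
    using sub[OF y(1)] d cN finite_nonpowers
    by (intro card_subset_eq) (auto simp: d_def)
  have cx: "centralizer x \<subseteq> ?P" using sub[OF x] PN by simp
  have "c = d"
  proof (rule ccontr)
    assume "c \<noteq> d"
    hence "c < d" using le by (simp add: c_def d_def)
    have "c dvd d"
      unfolding c_def d_def using card_subgroup_dvd[OF sx sP cx] .
    then obtain q where q: "d = c * q" by (rule dvdE)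
    have "2 \<le> q" using \<open>c < d\<close> by (cases q; cases "q - 1") (auto simp: q)
    hence "2 * c \<le> d" by (simp add: q)
    hence "2 * (card (conj_class x) * c) \<le> card (conj_class x) * d"
      by (metis mult.left_commute mult_le_mono2)
    \<comment> \<open>Here the order is counted twice through the class of \<open>x\<close> and once
      through that of \<open>y\<close>.\<close>
    hence "3 * order G \<le> n * d"
      using ox oy by (simp add: n algebra_simps)
    hence "3 * order G \<le> n * n + n" by (simp add: d)
    hence "n * n < 2 * n" using few by linarith
    moreover have "2 * n \<le> n * n" using two_le_n[OF x] by simp
    ultimately show False by linarith
  qed
  have xP: "centralizer x = ?P"
    using cx \<open>c = d\<close> fin by (intro card_subset_eq) (auto simp: c_def d_def)
  \<comment> \<open>Each \<open>u\<close> is conjugate to \<open>x\<close> or \<open>y\<close>, and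
    \<open>insert \<one> N\<close> is invariant under conjugation.\<close>
  have centralizer: "centralizer u = insert \<one> N" if u: "u \<in> N" for u
  proof -
    obtain g v where g: "g \<in> carrier G" "u = conjugate g v" "v \<in> carrier G" "centralizer v = insert \<one> N"
    proof -
      have "u \<in> conj_class x \<or> u \<in> conj_class y" using u NE E by blast
      thus ?thesis using that xG yG xP PN by (auto simp: conj_class_def)
    qed
    have "centralizer u = conjugate g ` insert \<one> N" using g centralizer_conjugate by simp
    also have "\<dots> \<subseteq> insert \<one> N"
      using g(1) order_p_conjugate NE by auto
    finally have "centralizer u \<subseteq> insert \<one> N" .
    moreover have "card (centralizer u) = card (insert \<one> N)"
      using g card_centralizer_conjugate by simp
    ultimately show ?thesis using finite_nonpowers by (intro card_subset_eq) auto
  qed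
  define m where "m = card (conj_class x)"
  have "card (conj_class y) * d = m * d" using ox oy \<open>c = d\<close> by (simp add: m_def)
  hence "card (conj_class y) = m" using \<open>n < d\<close> by simp
  hence nm: "n = 2 * m" using n by (simp add: m_def)
  have om: "order G = (n + 1) * m" using ox \<open>c = d\<close> d by (simp add: m_def)
  show "2 * order G = n * (n + 1)" using om nm by simp
  have "\<exists>H. (frobenius_complement G H \<or> m = 1 \<and> H = {\<one>}) \<and>
    card (frobenius_kernel G H) = n + 1 \<and> N = frobenius_kernel G H - {\<one>}"
    using frobenius_with_kernel[OF _ centralizer nm om] x NE by blast
  moreover have "order G = 3" if "m = 1" using om nm that by simp
  ultimately show "\<exists>H. (frobenius_complement G H \<or> order G = 3 \<and> H = {\<one>}) \<and>
      card (frobenius_kernel G H) = n + 1 \<and> N = frobenius_kernel G H - {\<one>}"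
    by metis
qed

text \<open>The nontrivial \<open>p\<close>-regular element \<open>z\<close> commuting with
  \<open>x\<close> is an involution and turns out to be central. The image of
  \<open>centralizer x\<close> modulo \<open>{\<one>, z}\<close> is normal and centralizes exactly
  itself, so \<open>self_centralizing_frobenius\<close> applies in the quotient
  \<open>F\<close>.\<close>

lemma double_cover:
  assumes x: "x \<in> order_p" "card (regular_centralizer x) = 2"
  shows "2 * order G = n * (n + 2)"
    and "\<exists>F :: 'a set monoid. \<exists>m. n = 2 * m \<and> frobenius_group F \<and> order F = m * (m + 1) \<and>
      central_extension G F"
proof -
  have xG: "x \<in> carrier G" "x [^] e \<noteq> \<one>" "x [^] p = \<one>"
    using x(1) order_p_pow[OF x(1)] by (auto simp: order_p_def)
  have cl: "order_p = conj_class x" by (rule card_regular_centralizer_two_single_class[OF x])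
  have fin: "finite (centralizer u)" for u using finG centralizer_subset finite_subset by blast
  let ?C = "centralizer x"
  have sC: "subgroup (centralizer u) G" if "u \<in> carrier G" for u using that by (rule subgroup_centralizer)
  interpret C: subgroup ?C G using xG(1) by (rule sC)
  define m where "m = card (conj_class x)"
  have m: "card order_p = m" by (simp add: m_def cl)
  have nm: "n = 2 * m"
    unfolding n_eq_sum using sum_regular_centralizer_conj_class[OF x(1)] x(2) by (simp add: m_def cl)
  have oG: "order G = m * card ?C" using card_conj_class[OF xG(1)] by (simp add: m_def)
  obtain z where z: "regular_centralizer x = {\<one>, z}" "z \<noteq> \<one>"
  proof -
    obtain a b where "regular_centralizer x = {a, b}" "a \<noteq> b" using x(2) by (auto simp: card_2_iff)
    thus ?thesis using that one_in_regular_centralizer[OF xG(1)] by (metis insertE insert_commute singletonD)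
  qed
  have zC: "z \<in> ?C" "z [^] e = \<one>" using z by (auto simp: regular_centralizer_def)
  have zG: "z \<in> carrier G" using zC C.subset by blast
  have regular_centralizer_iff: "w = \<one> \<or> w = z" if "w \<in> ?C" "w [^] e = \<one>" for w
    using that z(1) by (auto simp: regular_centralizer_def)
  have zz: "z \<otimes> z = \<one>"
  proof -
    have "(z \<otimes> z) [^] e = \<one>" using zC zG by (simp add: pow_mult_distrib)
    hence "z \<otimes> z = \<one> \<or> z \<otimes> z = z" using regular_centralizer_iff[of "z \<otimes> z"] zC by blast
    thus ?thesis using z zG by simp
  qed
  have zp: "z [^] p = z"
  proof -
    obtain q where q: "p = 2 * q + 1" using odd oddE by blast
    have "z [^] p = (z \<otimes> z) [^] q \<otimes> z"
      using zG by (simp add: q pow_mult_distrib nat_pow_mult mult_2)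
    thus ?thesis using zz zG by simp
  qed
  have inv_z: "inv z = z" using zz zG inv_equality by blast
  have sZ: "subgroup {\<one>, z} G"
    using zG zz inv_z by (intro subgroupI) auto
  have N_iff: "w \<in> N \<longleftrightarrow> w \<noteq> \<one> \<and> w \<noteq> z" if w: "w \<in> ?C" for w
  proof -
    have "w \<in> carrier G" using w by (rule C.mem_carrier)
    hence "w \<in> N \<longleftrightarrow> w [^] e \<noteq> \<one>" by (simp add: N_eq)
    also have "w [^] e = \<one> \<longleftrightarrow> w = \<one> \<or> w = z" using regular_centralizer_iff[OF w] zC(2) by auto
    finally show ?thesis by simp
  qed
  have sub: "?C - {\<one>, z} \<subseteq> N" using N_iff by blast
  have card_sub: "card (?C - {\<one>, z}) = card ?C - 2"
    using zC z(2) fin by (simp add: card_Diff_subset)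
  \<comment> \<open>The bounds are \<open>n < card ?C \<le> n + 2\<close>. Parity excludes
    \<open>n + 1\<close>: \<open>?C\<close> has a subgroup of order two and
    \<open>n = 2 * m\<close>.\<close>
  have cC: "card ?C = n + 2"
  proof -
    have "n * n < n * card ?C" using few oG nm by simp
    hence "n < card ?C" by simp
    moreover have "card ?C - 2 \<le> n" using card_le_n[OF sub] card_sub by simp
    moreover have "card {\<one>, z} = 2" using z(2) by auto
    hence "even (card ?C)"
      using card_subgroup_dvd[OF sZ sC[OF xG(1)]] zC by simp
    moreover have "even n" using nm by simp
    ultimately show ?thesis by presburger
  qed
  show "2 * order G = n * (n + 2)" using oG nm cC by simp
  have CN: "?C - {\<one>, z} = N"
    using sub card_sub cC finite_nonpowers n_eq by (intro card_subset_eq) auto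
  have N_conjugate: "conjugate g u \<in> N" if "g \<in> carrier G" "u \<in> N" for g u
    using that by (auto simp: N_eq conjugate_eq_one_iff simp flip: conjugate_pow)
  \<comment> \<open>The conjugation-invariant set \<open>N\<close> lies in \<open>?C\<close>, hence
    in every \<open>centralizer u\<close>; so does \<open>z\<close>, as the quotient of the
    nonpowers \<open>x \<otimes> z\<close> and \<open>x\<close>. Equal orders do the rest.\<close>
  have centralizer_eq: "centralizer u = ?C" if u: "u \<in> order_p" for u
  proof -
    obtain g where g: "g \<in> carrier G" "u = conjugate g x" using u cl by (auto simp: conj_class_def)
    have uG: "u \<in> carrier G" using g xG by simp
    interpret D: subgroup "centralizer u" G using uG by (rule sC)
    have N_sub: "N \<subseteq> centralizer u"
    proof
      fix w assume w: "w \<in> N"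
      hence wG: "w \<in> carrier G" by (simp add: N_eq)
      have "conjugate (inv g) w \<in> ?C" using N_conjugate[of "inv g" w] g w CN by auto
      hence "conjugate g (conjugate (inv g) w) \<in> centralizer u" using g xG centralizer_conjugate by blast
      thus "w \<in> centralizer u" using g wG by simp
    qed
    have "x \<otimes> z \<in> N"
    proof -
      have "z \<otimes> x = x \<otimes> z" using zC(1) unfolding centralizer_def by blast
      from pow_mult_distrib[OF this[symmetric] xG(1) zG]
      have "(x \<otimes> z) [^] e = x [^] e" using xG(1) zC(2) by simp
      thus ?thesis using xG(1,2) zG by (simp add: N_eq)
    qed
    moreover have "x \<in> N" using xG by (simp add: N_eq)
    ultimately have "inv x \<otimes> (x \<otimes> z) \<in> centralizer u" using N_sub by blast
    hence "z \<in> centralizer u" using xG zG by simp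
    hence "?C \<subseteq> centralizer u" using N_sub CN D.one_closed by blast
    moreover have "card (centralizer u) = card ?C" using g xG card_centralizer_conjugate by simp
    ultimately show ?thesis using fin by (metis card_subset_eq)
  qed
  have C_conjugate: "conjugate g w \<in> ?C" if g: "g \<in> carrier G" and w: "w \<in> ?C" for g w
  proof -
    have "conjugate g w \<in> centralizer (conjugate g x)" using that xG centralizer_conjugate by blast
    thus ?thesis using centralizer_eq order_p_conjugate[OF g x(1)] by simp
  qed
  \<comment> \<open>A conjugate of \<open>z\<close> stays in \<open>?C\<close> and is still
    \<open>p\<close>-regular, so \<open>z\<close> is the only candidate.\<close>
  have z_conjugate: "conjugate g z = z" if g: "g \<in> carrier G" for g
  proof -
    have "conjugate g z [^] e = \<one>" using g zG zC by (simp flip: conjugate_pow)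
    hence "conjugate g z = \<one> \<or> conjugate g z = z" using regular_centralizer_iff[of "conjugate g z"] C_conjugate[OF g zC(1)] by blast
    thus ?thesis using g zG z(2) by (simp add: conjugate_eq_one_iff)
  qed
  have central: "z \<otimes> g = g \<otimes> z" if g: "g \<in> carrier G" for g
  proof -
    have "g \<in> centralizer z" using z_conjugate[OF g] conjugate_eq_self_iff[OF g zG] by blast
    thus ?thesis unfolding centralizer_def by simp
  qed
  have nZ: "{\<one>, z} \<lhd> G"
    unfolding normal_inv_iff using sZ z_conjugate by (auto simp: conjugate_def)
  interpret Z: normal "{\<one>, z}" G by (rule nZ)
  define F where "F = G Mod {\<one>, z}"
  interpret F: group F unfolding F_def by (rule Z.factorgroup_is_group)
  define \<pi> where "\<pi> = (\<lambda>a. {\<one>, z} #> a)"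
  have \<pi>_hom: "group_hom G F \<pi>"
    unfolding F_def \<pi>_def using Z.r_coset_hom_Mod Z.factorgroup_is_group is_group
    by (simp add: group_hom_def group_hom_axioms_def)
  interpret \<pi>: group_hom G F \<pi> by (rule \<pi>_hom)
  have \<pi>_surj: "\<pi> ` carrier G = carrier F"
    by (simp add: \<pi>_def F_def carrier_FactGroup)
  have \<pi>_eq: "\<pi> a = {a, z \<otimes> a}" if "a \<in> carrier G" for a
    using that by (auto simp: \<pi>_def r_coset_def)
  have \<pi>_eqD: "a = b \<or> a = z \<otimes> b" if "\<pi> a = \<pi> b" "a \<in> carrier G" "b \<in> carrier G" for a b
    using that \<pi>_eq by (metis insertI1 insertE singletonD)
  have zu: "(z \<otimes> u) [^] p \<noteq> \<one>" if u: "u \<in> carrier G" "u [^] p = \<one>" for u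
  proof -
    have "(z \<otimes> u) [^] p = z [^] p \<otimes> u [^] p"
      by (rule pow_mult_distrib[OF central[OF u(1)] zG u(1)])
    thus ?thesis using u zp z(2) zG by simp
  qed
  \<comment> \<open>A set of representatives for the cosets of \<open>{\<one>, z}\<close> in
    \<open>?C\<close>, from which the order of \<open>P\<close> is read off.\<close>
  define E where "E = insert \<one> order_p"
  have E: "u \<in> carrier G" "u [^] p = \<one>" if "u \<in> E" for u
    using that by (auto simp: E_def order_p_def)
  define P where "P = \<pi> ` ?C"
  have PE: "P = \<pi> ` E"
  proof
    have "order_p \<subseteq> ?C" using order_p_subset_N CN by blast
    thus "\<pi> ` E \<subseteq> P" unfolding P_def E_def using C.one_closed by blast
    show "P \<subseteq> \<pi> ` E"
    proof
      fix X assume "X \<in> P"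
      then obtain w where w: "w \<in> ?C" "X = \<pi> w" by (auto simp: P_def)
      have wz: "\<pi> (u \<otimes> v) = \<pi> u" if "v \<in> {\<one>, z}" "u \<in> carrier G" for u v
      proof (cases "v = z")
        case True
        have "z \<otimes> (z \<otimes> u) = u" using zG zz that(2) by (simp flip: m_assoc)
        moreover have "u \<otimes> v = z \<otimes> u" using True central[OF that(2)] by simp
        ultimately show ?thesis using zG that(2) by (auto simp: \<pi>_eq)
      qed (use that in auto)
      have "\<exists>u\<in>E. \<exists>v\<in>{\<one>, z}. w = u \<otimes> v"
      proof (cases "w \<in> N")
        case True
        then obtain u v where uv: "u \<in> order_p" "v \<in> regular_centralizer u" "w = u \<otimes> v" by (rule N_decompose)
        hence "v \<in> regular_centralizer x" using centralizer_eq by (simp add: regular_centralizer_def)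
        thus ?thesis using uv z(1) by (auto simp: E_def)
      next
        case False
        hence "w = \<one> \<or> w = z" using w N_iff by blast
        thus ?thesis using zG by (auto simp: E_def)
      qed
      thus "X \<in> \<pi> ` E" using w(2) wz E(1) by force
    qed
  qed
  have inj: "inj_on \<pi> E"
  proof (rule inj_onI)
    fix a b assume ab: "a \<in> E" "b \<in> E" "\<pi> a = \<pi> b"
    hence "a = b \<or> a = z \<otimes> b" using \<pi>_eqD E by blast
    thus "a = b" using zu[of b] E ab by auto
  qed
  \<comment> \<open>The factor \<open>1\<close> matches the form \<open>k * m + 1\<close> in
    \<open>self_centralizing_frobenius\<close>; \<open>m\<close> is both the number of nonidentity
    elements of \<open>P\<close> and its index.\<close>
  have cP: "card P = 1 * m + 1"
    unfolding PE card_image[OF inj] using m finite_order_p by (simp add: E_def order_p_def)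
  have oF: "order F = card P * m"
  proof -
    have "card (rcosets {\<one>, z}) * card {\<one>, z} = order G" by (rule lagrange[OF sZ])
    hence "order F * 2 = order G" using z(2) by (simp add: F_def order_def FactGroup_def)
    thus ?thesis using oG cC nm cP by (simp add: algebra_simps)
  qed
  have "?C \<lhd> G"
    unfolding normal_inv_iff using C.subgroup_axioms C_conjugate by (simp add: conjugate_def)
  hence nP: "P \<lhd> F"
    unfolding P_def using normal.surj_hom_normal_subgroup \<pi>_hom \<pi>_surj by blast
  have finF: "finite (carrier F)"
    using finG \<pi>_surj by (metis finite_imageI)
  have centF: "F.centralizer U = P" if U: "U \<in> P" "U \<noteq> \<one>\<^bsub>F\<^esub>" for U
  proof -
    obtain u where u: "u \<in> E" "U = \<pi> u" using U PE by auto
    have "u \<noteq> \<one>" using u U \<pi>.hom_one by auto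
    hence ue: "u \<in> order_p" using u by (simp add: E_def)
    have uG: "u \<in> carrier G" using ue order_p_pow by blast
    show ?thesis
    proof
      show "P \<subseteq> F.centralizer U"
      proof
        fix W assume "W \<in> P"
        then obtain w where w: "w \<in> ?C" "W = \<pi> w" by (auto simp: P_def)
        have "w \<in> centralizer u" using w(1) centralizer_eq[OF ue] by simp
        hence wG: "w \<in> carrier G" and comm: "w \<otimes> u = u \<otimes> w"
          unfolding centralizer_def by blast+
        have "\<pi> w \<otimes>\<^bsub>F\<^esub> \<pi> u = \<pi> u \<otimes>\<^bsub>F\<^esub> \<pi> w"
          using arg_cong[OF comm, of \<pi>] wG uG by (simp only: \<pi>.hom_mult)
        thus "W \<in> F.centralizer U"
          using w(2) u(2) \<pi>.hom_closed[OF wG] unfolding F.centralizer_def by blast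
      qed
      show "F.centralizer U \<subseteq> P"
      proof
        fix W assume W: "W \<in> F.centralizer U"
        hence "W \<in> carrier F" by (simp add: F.centralizer_def)
        then obtain g where g: "g \<in> carrier G" "W = \<pi> g" using \<pi>_surj by blast
        have "\<pi> (g \<otimes> u) = \<pi> (u \<otimes> g)"
          using W g(2) u(2) unfolding \<pi>.hom_mult[OF g(1) uG] \<pi>.hom_mult[OF uG g(1)] F.centralizer_def
          by blast
        hence "g \<otimes> u = u \<otimes> g \<or> g \<otimes> u = z \<otimes> (u \<otimes> g)"
          using \<pi>_eqD g uG by simp
        \<comment> \<open>A conjugate of \<open>u\<close> has trivial \<open>p\<close>-th power,
          whereas \<open>z \<otimes> u\<close> has not; so commuting modulo \<open>z\<close> is
          commuting.\<close>
        moreover have "g \<otimes> u \<noteq> z \<otimes> (u \<otimes> g)"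
        proof
          assume "g \<otimes> u = z \<otimes> (u \<otimes> g)"
          hence "conjugate g u = z \<otimes> u" using g uG zG by (simp add: conjugate_def m_assoc)
          moreover have "conjugate g u [^] p = \<one>"
            using order_p_conjugate[OF g(1) ue] by (simp add: order_p_def)
          ultimately show False using zu[of u] E u by simp
        qed
        ultimately have "g \<in> centralizer u" using g(1) unfolding centralizer_def by blast
        thus "W \<in> P" using g centralizer_eq[OF ue] by (simp add: P_def)
      qed
    qed
  qed
  obtain H where H: "P \<noteq> {\<one>\<^bsub>F\<^esub>} \<Longrightarrow> P \<noteq> carrier F \<Longrightarrow> frobenius_complement F H"
    using F.self_centralizing_frobenius[OF nP finF centF cP oF] by metis
  have m2: "2 \<le> m"
    using card_mono[OF finite_order_p, of "{x, inv x}"] m x order_p_inv[OF x(1)] inv_ne[OF x(1)]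
    by fastforce
  have "P \<noteq> {\<one>\<^bsub>F\<^esub>}" using cP m2 by auto
  moreover have "P \<noteq> carrier F"
  proof
    assume "P = carrier F"
    hence "card P * m = card P" using oF unfolding order_def by metis
    thus False using cP m2 by (metis add_is_0 mult_cancel1 mult.right_neutral
        one_neq_zero numeral_le_one_iff semiring_norm(69))
  qed
  ultimately have "frobenius_group F"
    unfolding frobenius_group_def using F.is_group finF H by blast
  moreover have "central_extension G F"
    unfolding central_extension_def
  proof (intro exI conjI)
    show "subgroup {\<one>, z} G" by (rule sZ)
    show "\<forall>w\<in>{\<one>, z}. \<forall>g\<in>carrier G. w \<otimes> g = g \<otimes> w" using central by simp
    show "G Mod {\<one>, z} \<cong> F" by (simp add: F_def iso_refl)
  qed
  moreover have "order F = m * (m + 1)" using oF cP by simp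
  ultimately show "\<exists>F :: 'a set monoid. \<exists>m. n = 2 * m \<and> frobenius_group F \<and>
      order F = m * (m + 1) \<and> central_extension G F"
    using nm by blast
qed

end

section \<open>Choice of the exponent\<close>

context group
begin

text \<open>The number \<open>p * (p ^ a * m)\<close> is an exponent of \<open>G\<close> with the smallest possible \<open>p\<close>-part,
  and \<open>x\<close> is a \<open>p\<close>-element of the largest possible order.\<close>

lemma p_exponent:
  assumes fin: "finite (carrier G)" and p: "prime p" "p dvd order G"
  obtains a m x where "\<And>y. y \<in> carrier G \<Longrightarrow> y [^] (p * (p ^ a * m)) = \<one>"
    "\<not> p dvd m" "x \<in> carrier G" "x [^] (p ^ Suc a) = \<one>" "x [^] (p ^ a * m) \<noteq> \<one>"
proof -
  have o: "order G \<noteq> 0" using fin order_gt_0_iff_finite by auto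
  obtain b m where bm: "order G = p ^ b * m" "\<not> p dvd m"
    using multiplicity_decompose'[of "order G" p] o p(1) by (metis not_prime_unit)
  have cpm: "coprime p m" by (rule prime_imp_coprime[OF p(1) bm(2)])
  define Q where "Q a \<longleftrightarrow> (\<forall>y\<in>carrier G. y [^] (p ^ a * m) = \<one>)" for a
  have "Q b" unfolding Q_def using pow_order_eq_1 bm by simp
  moreover have "\<not> Q 0"
  proof
    \<comment> \<open>Then a nonidentity element of a Sylow \<open>p\<close>-subgroup would be
      killed both by a power of \<open>p\<close> and by \<open>m\<close>.\<close>
    assume Q0: "Q 0"
    obtain H where H: "subgroup H G" "card H = p ^ b"
      using sylow_thm[OF p(1) is_group bm(1) fin] by blast
    have "b \<noteq> 0" using bm p by (metis mult_1 power_0)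
    hence "card H > 1" using H p(1) by (metis one_less_power prime_gt_1_nat neq0_conv)
    hence "H \<noteq> {\<one>}" by auto
    then obtain h where h: "h \<in> H" "h \<noteq> \<one>"
      using H subgroup.one_closed by blast
    interpret K: group "G\<lparr>carrier := H\<rparr>"
      using H by (simp add: subgroup_imp_group)
    have "h [^]\<^bsub>G\<lparr>carrier := H\<rparr>\<^esub> order (G\<lparr>carrier := H\<rparr>) = \<one>"
      using h K.pow_order_eq_1[of h] by simp
    hence "h [^] (p ^ b) = \<one>" using H by (simp add: order_def flip: nat_pow_consistent)
    moreover have hG: "h \<in> carrier G" using h H subgroup.subset by blast
    moreover have "h [^] m = \<one>" using Q0 hG by (simp add: Q_def)
    moreover have "coprime (p ^ b) m" using cpm by simp
    ultimately show False using pow_coprime_eq_one h by blast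
  qed
  \<comment> \<open>The point at which \<open>Q\<close> changes from false to true between
    \<open>0\<close> and \<open>b\<close>.\<close>
  ultimately obtain a where a: "\<not> Q a" "Q (Suc a)"
  proof -
    assume Q: "Q b" "\<not> Q 0" and thesis: "\<And>a. \<not> Q a \<Longrightarrow> Q (Suc a) \<Longrightarrow> thesis"
    have "thesis \<or> \<not> Q i" for i
      using Q(2) thesis by (induction i) blast+
    thus thesis using Q(1) by blast
  qed
  obtain y where y: "y \<in> carrier G" "y [^] (p ^ a * m) \<noteq> \<one>" using a by (auto simp: Q_def)
  show ?thesis
  proof (rule that[of a m "y [^] m"])
    show "u [^] (p * (p ^ a * m)) = \<one>" if "u \<in> carrier G" for u
      using a(2) that by (simp add: Q_def mult.assoc)
    show "(y [^] m) [^] (p ^ Suc a) = \<one>"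
      using a(2) y by (simp add: Q_def nat_pow_pow mult.commute mult.left_commute)
    show "(y [^] m) [^] (p ^ a * m) \<noteq> \<one>"
    proof
      \<comment> \<open>The element \<open>y [^] (p ^ a * m)\<close> has order \<open>p\<close>, so
        raising it to the power \<open>m\<close>, which is prime to \<open>p\<close>, cannot kill
        it.\<close>
      assume *: "(y [^] m) [^] (p ^ a * m) = \<one>"
      have "(y [^] (p ^ a * m)) [^] m = (y [^] m) [^] (p ^ a * m)"
        using y by (simp add: nat_pow_pow mult.commute)
      moreover have "(y [^] (p ^ a * m)) [^] p = \<one>"
        using a(2) y by (simp add: Q_def nat_pow_pow mult.commute mult.left_commute)
      ultimately show False
        using pow_coprime_eq_one[OF _ _ _ cpm, of "y [^] (p ^ a * m)"] y * by simp
    qed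
  qed (use y bm in auto)
qed

end

section \<open>The case distinction by regular centralizers and numbers of classes\<close>

theorem theorem3:
  fixes G :: "('a, 'b) monoid_scheme" and p n :: nat
  assumes "group G" and "finite (carrier G)"
    and "prime p" and "odd p" and "p dvd order G"
    and "n = card (non_kth_powers G p)"
  shows
    "(order G = n * (n + 1) \<and>
       (\<exists>H. frobenius_complement G H \<and> card (frobenius_kernel G H) = n + 1 \<and>
            non_kth_powers G p = frobenius_kernel G H - {\<one>\<^bsub>G\<^esub>}))
     \<or> (real (order G) = real n / 2 * (real n + 2) \<and>
       (\<exists>F :: 'a set monoid. frobenius_group F \<and>
            real (order F) = real n / 2 * (real n / 2 + 1) \<and> central_extension G F))
     \<or> (real (order G) = real n / 2 * (real n + 1) \<and>
       (\<exists>H. (frobenius_complement G H \<or> order G = 3 \<and> H = {\<one>\<^bsub>G\<^esub>}) \<and>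
            card (frobenius_kernel G H) = n + 1 \<and>
            non_kth_powers G p = frobenius_kernel G H - {\<one>\<^bsub>G\<^esub>}))
     \<or> real (order G) \<le> (real n)\<^sup>2 / 2"
proof (cases "n * n < 2 * order G")
  case False
  hence "real (2 * order G) \<le> real (n * n)" by (simp only: of_nat_le_iff not_less)
  thus ?thesis by (simp add: power2_eq_square)
next
  case True
  interpret group G by fact
  obtain a m x where am: "\<And>y. y \<in> carrier G \<Longrightarrow> y [^]\<^bsub>G\<^esub> (p * (p ^ a * m)) = \<one>\<^bsub>G\<^esub>"
    "\<not> p dvd m" "x \<in> carrier G" "x [^]\<^bsub>G\<^esub> (p ^ Suc a) = \<one>\<^bsub>G\<^esub>" "x [^]\<^bsub>G\<^esub> (p ^ a * m) \<noteq> \<one>\<^bsub>G\<^esub>"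
    using p_exponent assms(2,3,5) by blast
  interpret few_nonpowers G p n "p ^ a * m"
    by unfold_locales (use assms am True in auto)
  \<comment> \<open>For positive \<open>a\<close> the element \<open>x\<close> would contradict
    \<open>not_p_dvd_e\<close>; so \<open>e\<close> is \<open>m\<close>, which is prime to
    \<open>p\<close>.\<close>
  have a0: "a = 0"
    using not_p_dvd_e[OF refl _ am(3,5,4)] by blast
  interpret few_nonpowers_coprime G p n "p ^ a * m"
    by unfold_locales (use prime_imp_coprime[OF prime am(2)] in \<open>simp add: a0\<close>)
  have x: "x \<in> order_p" using am a0 by (auto simp: order_p_def)
  \<comment> \<open>If some element of order \<open>p\<close> commutes with a nontrivial
    \<open>p\<close>-regular element, (2) follows; otherwise the number of classes of elements of
    order \<open>p\<close> decides between (1) and (3).\<close>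
  show ?thesis
  proof (cases "\<exists>u\<in>order_p. card (regular_centralizer u) \<noteq> 1")
    case True
    then obtain u where u: "u \<in> order_p" "card (regular_centralizer u) \<noteq> 1" by blast
    hence R2: "card (regular_centralizer u) = 2"
      using card_regular_centralizer_le[of u] card_regular_centralizer_pos[of u] by linarith
    note D = double_cover[OF u(1) R2]
    obtain F :: "'a set monoid" and k where F: "n = 2 * k" "frobenius_group F"
      "order F = k * (k + 1)" "central_extension G F"
      using D(2) by blast
    have "real (2 * order G) = real (n * (n + 2))" using D(1) by presburger
    hence "real (order G) = real n / 2 * (real n + 2)" by (simp add: algebra_simps)
    moreover have "real (order F) = real n / 2 * (real n / 2 + 1)"
      using F(1,3) by (simp add: algebra_simps)
    ultimately show ?thesis using F by blast
  next
    case False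
    hence R1: "\<And>u. u \<in> order_p \<Longrightarrow> card (regular_centralizer u) = 1" by blast
    show ?thesis
    proof (cases "order_p = conj_class x")
      case True
      show ?thesis using single_class[OF x True R1] by blast
    next
      case False
      then obtain y where y: "y \<in> order_p" "y \<notin> conj_class x" using order_p_conj_class[OF x] by blast
      have "x \<notin> conj_class y"
        using y x conj_class_eq conj_class_self order_p_pow by blast
      \<comment> \<open>The elements \<open>x\<close> and \<open>y\<close> are named so that the
        second centralizer is at least as large as the first.\<close>
      then obtain u v where "u \<in> order_p" "v \<in> order_p" "v \<notin> conj_class u" "card (centralizer u) \<le> card (centralizer v)"
        using x y nat_le_linear by blast
      note D = two_classes[OF this(1-3) R1 this(4)]
      have "real (2 * order G) = real (n * (n + 1))" using D(1) by presburger
      hence "real (order G) = real n / 2 * (real n + 1)" by (simp add: algebra_simps)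
      thus ?thesis using D(2) by blast
    qed
  qed
qed

end
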